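(* Let $d\ge 5$ be an integer. Then for every real $c>0$ there are infinitely many integers $n>0$ such that there are more than $c^n$ pairwise nonisomorphic $d$-regular $(d-1)$-connected graphs with $n$ vertices that do not contain a subdivision of $K_{d+1}$.
   Context: All graphs are finite and have no loops or parallel edges. A subdivision of a graph $H$ is a graph $J$ such that $H$ can be obtained from $J$ by repeatedly contracting an edge incident with a vertex of degree two (equivalently, $J$ is obtained from $H$ by replacing edges by internally disjoint paths); $G$ contains a subdivision of $H$ if some subgraph of $G$ is a subdivision of $H$. $K_{d+1}$ is the complete graph on $d+1$ vertices. Connectivity is vertex-connectivity. *)

theory Defs
  imports Complex_Main "Graph_Theory.Graph_Theory"
begin

(* A finite simple graph is a pair_graph: a finite, loopless, symmetric set of ordered pairs,
   an edge {u,v} being represented by the two arcs (u,v) and (v,u).  Hence out_degree is the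
   usual degree, and the absence of parallel edges is built into the type. *)

definition regular_graph :: "nat \<Rightarrow> 'a pair_pre_digraph \<Rightarrow> bool" where
  "regular_graph d G \<longleftrightarrow> pair_graph G \<and> (\<forall>v \<in> pverts G. out_degree (with_proj G) v = d)"

(* Vertex connectivity at least k, with the usual convention that there are more than k vertices.
   The qualified name avoids topological connectedness. *)
definition k_connected :: "nat \<Rightarrow> 'a pair_pre_digraph \<Rightarrow> bool" where
  "k_connected k G \<longleftrightarrow> pair_graph G \<and> k < card (pverts G) \<and>
     (\<forall>X \<subseteq> pverts G. card X < k \<longrightarrow>
        Digraph_Component.connected (with_proj G \<restriction> (pverts G - X)))"

(* Subdividing an edge of H (see subdivision_pair_intros) keeps the vertices of H, so H lives on
   the branch vertices in G; quantify over H to get containment up to isomorphism.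
   The pair representation matters: the library's subdivision keeps the tail and head functions
   of H and G equal, and only for pairs is every possible edge available as an arc of H. *)
definition contains_subdivision :: "'a pair_pre_digraph \<Rightarrow> 'a pair_pre_digraph \<Rightarrow> bool" where
  "contains_subdivision G H \<longleftrightarrow>
     (\<exists>J. subgraph (with_proj J) (with_proj G) \<and> subdivision_pair H J)"

definition contains_complete_subdivision :: "nat \<Rightarrow> 'a pair_pre_digraph \<Rightarrow> bool" where
  "contains_complete_subdivision m G \<longleftrightarrow>
     (\<exists>H. complete_digraph m (with_proj H) \<and> contains_subdivision G H)"

end

theory Submission
  imports Defs "HOL-Combinatorics.Permutations" "HOL-Library.FuncSet"
begin

text \<open>In a subdivision of \<open>K\<^bsub>d+1\<^esub>\<close> inside a \<open>d\<close>-regular graph every edge at a branch vertex is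
  used, so a vertex that is not a branch vertex has at most two branch neighbours. A piece \<open>P\<close> is
  the complement of a tree on \<open>d + 2\<close> vertices, with \<open>d\<close> edges leaving it, among which there is a path
  \<open>p w' w q\<close> with \<open>p, w \<in> P\<close> and \<open>w', q \<notin> P\<close>. If \<open>P\<close> contained \<open>k\<close> branch vertices with
  \<open>1 \<le> k \<le> d\<close>, then \<open>k (d + 1 - k) \<ge> d\<close> disjoint paths would leave \<open>P\<close>, so each of the \<open>d\<close> edges would lie on
  its own path; then \<open>w\<close> and \<open>w'\<close> are both branch vertices, and both sides contain at least two of
  them, which makes \<open>k (d + 1 - k) > d\<close>. Hence all branch vertices lie in one piece, and the single
  remaining vertex of that piece has at least three branch neighbours, a contradiction.

  Contracting the pieces, and dropping the middle edge \<open>w w'\<close>, leaves a \<open>(d - 1)\<close>-regular multigraph whose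
  edges come from a matching; if it is \<open>(d - 1)\<close>-edge-connected, the graph is \<open>(d - 1)\<close>-connected.
  Two copies of a \<open>(d - 3)\<close>-edge-connected cyclic multigraph on \<open>m\<close> vertices, joined by doubled
  matching edges, qualify, even after permuting one copy. This gives \<open>(m - 1)!\<close> labelled graphs with
  a common connected spanning subgraph, and because of the latter each isomorphism class contains
  only exponentially many of them.\<close>

section \<open>Subdivisions encoded as arc labellings\<close>

text \<open>\<open>L\<close> sends each arc of the subdivision \<open>J\<close> to the edge of \<open>H\<close> (as an unordered pair) on whose
  path it lies. These properties survive a subdivision step and replace the paths themselves.\<close>

locale branch_labelling =
  fixes H J :: "'a pair_pre_digraph" and L :: "'a \<times> 'a \<Rightarrow> 'a set"
  assumes label_edge: "(x, y) \<in> parcs J \<Longrightarrow> \<exists>u v. (u, v) \<in> parcs H \<and> L (x, y) = {u, v}"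
    and arc_sym: "(x, y) \<in> parcs J \<Longrightarrow> (y, x) \<in> parcs J"
    and label_sym: "(x, y) \<in> parcs J \<Longrightarrow> L (y, x) = L (x, y)"
    and label_inner: "\<lbrakk>(x, y) \<in> parcs J; (x, y') \<in> parcs J; x \<notin> pverts H\<rbrakk> \<Longrightarrow> L (x, y) = L (x, y')"
    and label_branch: "\<lbrakk>(x, y) \<in> parcs J; x \<in> pverts H\<rbrakk> \<Longrightarrow> x \<in> L (x, y)"
    and label_cut: "\<lbrakk>(u, v) \<in> parcs H; u \<in> S; v \<notin> S\<rbrakk> \<Longrightarrow>
        \<exists>x y. (x, y) \<in> parcs J \<and> x \<in> S \<and> y \<notin> S \<and> L (x, y) = {u, v}"

text \<open>Induction over the subdivision steps. In \<open>H\<close> itself each arc is labelled by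
  its own two ends; when an edge is divided by \<open>w\<close>, the four new arcs inherit the label
  of the edge that they replace.\<close>

lemma subdivision_pair_labelling:
  assumes "subdivision_pair H J"
  shows "pverts H \<subseteq> pverts J \<and> (\<exists>L. branch_labelling H J L)"
  using assms
proof (induct rule: subdivision_pair_induct)
  case base
  interpret pair_bidirected_digraph H by fact
  have sym: "(y, x) \<in> parcs H" if "(x, y) \<in> parcs H" for x y
    using that arcs_symmetric by blast
  have "branch_labelling H H (\<lambda>(x, y). {x, y})"
  proof
    fix S u v assume "(u, v) \<in> parcs H" "u \<in> S" "v \<notin> S"
    then show "\<exists>x y. (x, y) \<in> parcs H \<and> x \<in> S \<and> y \<notin> S \<and> (case (x, y) of (x, y) \<Rightarrow> {x, y}) = {u, v}"
      by auto
  qed (use sym wellformed' in \<open>auto intro: insert_commute\<close>)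
  then show ?case by blast
next
  case (divide e w J)
  obtain a b where e: "e = (a, b)" by (cases e)
  from divide(4) obtain L where sub: "pverts H \<subseteq> pverts J" and L: "branch_labelling H J L"
    by blast
  interpret J: pair_bidirected_digraph J
    using divide(3) by (rule bidirected_digraphI_subdivision)
  have ab: "(a, b) \<in> parcs J" "(b, a) \<in> parcs J" "a \<noteq> b"
    using divide(1) J.arcs_symmetric J.adj_not_same by (auto simp: e)
  have w: "w \<notin> pverts H" "\<And>x. (x, w) \<notin> parcs J" "\<And>x. (w, x) \<notin> parcs J" "a \<noteq> w" "b \<noteq> w"
    using divide(2) sub J.wellformed' ab by auto
  interpret L: branch_labelling H J L by (rule L)
  define L' where "L' = (\<lambda>(x, y). if x = w \<or> y = w then L (a, b) else L (x, y))"
  let ?J = "subdivide J e w"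
  have arcs: "parcs ?J = (parcs J - {(a, b), (b, a)}) \<union> {(a, w), (w, a), (w, b), (b, w)}"
    by (simp add: e subdivide.simps)
  \<comment> \<open>Each arc of the divided graph borrows its label from an arc of \<open>J\<close>
    with the same tail, and at \<open>w\<close> always from \<open>(a, b)\<close>; the control over
    the tail is what carries over \<open>label_inner\<close> and
    \<open>label_branch\<close>.\<close>
  have lab: "\<exists>c d. (c, d) \<in> parcs J \<and> L' (x, y) = L (c, d) \<and> (x \<noteq> w \<longrightarrow> c = x) \<and> (x = w \<longrightarrow> (c, d) = (a, b))"
    if xy: "(x, y) \<in> parcs ?J" for x y
  proof -
    consider "x = w" | "x = a" "y = w" | "x = b" "y = w" | "x \<noteq> w" "y \<noteq> w" "(x, y) \<in> parcs J"
      using xy w unfolding arcs by auto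
    then show ?thesis
    proof cases
      case 3
      then show ?thesis using ab w L.label_sym[OF ab(1)] by (intro exI[of _ b] exI[of _ a]) (simp add: L'_def)
    qed (use ab w in \<open>auto simp: L'_def\<close>)
  qed
  have "branch_labelling H ?J L'"
  proof
    fix x y assume xy: "(x, y) \<in> parcs ?J"
    obtain c d where cd: "(c, d) \<in> parcs J" "L' (x, y) = L (c, d)" using lab[OF xy] by blast
    show "\<exists>u v. (u, v) \<in> parcs H \<and> L' (x, y) = {u, v}"
      using L.label_edge[OF cd(1)] cd(2) by simp
    show "(y, x) \<in> parcs ?J" "L' (y, x) = L' (x, y)"
      using xy w L.arc_sym L.label_sym unfolding arcs L'_def by auto
    show "x \<in> L' (x, y)" if "x \<in> pverts H"
    proof -
      have "x \<noteq> w" using that w(1) by blast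
      then obtain d where "(x, d) \<in> parcs J" "L' (x, y) = L (x, d)" using lab[OF xy] by blast
      then show ?thesis using L.label_branch that by auto
    qed
  next
    fix x y y' assume xy: "(x, y) \<in> parcs ?J" "(x, y') \<in> parcs ?J" "x \<notin> pverts H"
    show "L' (x, y) = L' (x, y')"
    proof (cases "x = w")
      case False
      obtain d where d: "(x, d) \<in> parcs J" "L' (x, y) = L (x, d)"
        using lab[OF xy(1)] False by blast
      obtain d' where "(x, d') \<in> parcs J" "L' (x, y') = L (x, d')"
        using lab[OF xy(2)] False by blast
      with d show ?thesis using L.label_inner[of x d d'] xy(3) by simp
    qed (simp add: L'_def)
  next
    fix S u v assume uv: "(u, v) \<in> parcs H" "u \<in> S" "v \<notin> S"
    obtain x y where xy: "(x, y) \<in> parcs J" "x \<in> S" "y \<notin> S" "L (x, y) = {u, v}"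
      using L.label_cut[OF uv] by blast
    then have nw: "x \<noteq> w" "y \<noteq> w" using w by auto
    show "\<exists>x y. (x, y) \<in> parcs ?J \<and> x \<in> S \<and> y \<notin> S \<and> L' (x, y) = {u, v}"
    proof (cases "(x, y) = (a, b) \<or> (x, y) = (b, a)")
      case True
      then have "(x, w) \<in> parcs ?J" "(w, y) \<in> parcs ?J" "L' (x, w) = {u, v}" "L' (w, y) = {u, v}"
        using xy L.label_sym[OF ab(1)] nw by (auto simp: arcs L'_def)
      then show ?thesis using xy(2,3) by blast
    next
      case False
      then have "(x, y) \<in> parcs ?J" "L' (x, y) = {u, v}"
        using xy nw by (auto simp: arcs L'_def)
      then show ?thesis using xy by blast
    qed
  qed
  moreover have "pverts H \<subseteq> pverts ?J" using sub by (auto simp: e subdivide.simps)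
  ultimately show ?case by blast
qed

section \<open>Branch vertices of a complete subdivision in a regular graph\<close>

locale regular_complete_subdivision = branch_labelling H J L
  for H J :: "'a pair_pre_digraph" and L +
  fixes G :: "'a pair_pre_digraph" and d :: nat
  assumes regular: "regular_graph d G"
    and complete: "complete_digraph (d + 1) (with_proj H)"
    and J_arcs: "parcs J \<subseteq> parcs G"
begin

lemma branch_finite: "finite (pverts H)"
  and branch_card: "card (pverts H) = d + 1"
  and branch_arcs: "(u, v) \<in> parcs H \<longleftrightarrow> u \<in> pverts H \<and> v \<in> pverts H \<and> u \<noteq> v"
  using complete by (auto simp: complete_digraph_pair_def)

lemma pair_graph_G: "pair_graph G"
  using regular by (simp add: regular_graph_def)

lemma finite_arcs_G: "finite (parcs G)"
proof -
  interpret G: pair_graph G by (rule pair_graph_G)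
  show ?thesis by (rule G.pair_finite_arcs)
qed

text \<open>For the cut around the single vertex \<open>a\<close>, \<open>label_cut\<close> yields
  \<open>d\<close> different labels on arcs of \<open>J\<close> leaving \<open>a\<close>. Only
  \<open>d\<close> arcs of \<open>G\<close> leave \<open>a\<close>, so all of them are used.\<close>

lemma arcs_at_branch_used:
  assumes "a \<in> pverts H" "(a, y) \<in> parcs G"
  shows "(a, y) \<in> parcs J"
proof -
  let ?A = "{e \<in> parcs G. fst e = a}" and ?B = "{e \<in> parcs J. fst e = a}"
  interpret G: pair_graph G by (rule pair_graph_G)
  have cardA: "card ?A = d"
    using regular assms G.wellformed' by (auto simp: regular_graph_def out_degree_def out_arcs_def)
  have sub: "?B \<subseteq> ?A" using J_arcs by auto
  have img: "(\<lambda>b. {a, b}) ` (pverts H - {a}) \<subseteq> L ` ?B"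
  proof
    fix l assume "l \<in> (\<lambda>b. {a, b}) ` (pverts H - {a})"
    then obtain b where b: "b \<in> pverts H" "b \<noteq> a" "l = {a, b}" by auto
    then have "\<exists>x y. (x, y) \<in> parcs J \<and> x \<in> {a} \<and> y \<notin> {a} \<and> L (x, y) = {a, b}"
      using assms by (intro label_cut) (auto simp: branch_arcs)
    then show "l \<in> L ` ?B" using b by force
  qed
  have fin: "finite ?B" using finite_arcs_G sub by (simp add: finite_subset)
  have "d = card ((\<lambda>b. {a, b}) ` (pverts H - {a}))"
    using assms branch_finite branch_card
    by (subst card_image) (auto simp: inj_on_def doubleton_eq_iff card_Diff_singleton)
  also have "\<dots> \<le> card (L ` ?B)" using img fin by (intro card_mono) auto
  also have "\<dots> \<le> card ?B" using fin by (rule card_image_le)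
  finally have "card ?A \<le> card ?B" using cardA by simp
  then have "?A = ?B" using sub finite_arcs_G by (intro card_seteq[symmetric]) auto
  moreover have "(a, y) \<in> ?A" using assms by simp
  ultimately have "(a, y) \<in> ?B" by (rule subst)
  then show ?thesis by simp
qed

text \<open>Arcs between \<open>z\<close> and branch vertices lie in \<open>J\<close>. All arcs of
  \<open>J\<close> at \<open>z\<close> carry one label \<open>{u, v}\<close>, and a branch neighbour
  belongs to the label of its arc, so it is \<open>u\<close> or \<open>v\<close>.\<close>

lemma inner_vertex_branch_neighbours:
  assumes "z \<notin> pverts H"
  shows "card {y \<in> pverts H. (z, y) \<in> parcs G} \<le> 2"
proof (cases "{y \<in> pverts H. (z, y) \<in> parcs G} = {}")
  case False
  interpret G: pair_graph G by (rule pair_graph_G)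
  have J: "(z, y) \<in> parcs J" if "y \<in> pverts H" "(z, y) \<in> parcs G" for y
    using arc_sym arcs_at_branch_used G.arcs_symmetric that by blast
  from False obtain y where y: "y \<in> pverts H" "(z, y) \<in> parcs G" by blast
  obtain u v where uv: "L (z, y) = {u, v}" using label_edge J y by blast
  have "{y \<in> pverts H. (z, y) \<in> parcs G} \<subseteq> {u, v}"
  proof
    fix x assume x: "x \<in> {y \<in> pverts H. (z, y) \<in> parcs G}"
    then have "L (z, x) = {u, v}" using label_inner[of z x y] J y assms uv by simp
    moreover have "x \<in> L (x, z)" using x J arc_sym label_branch by auto
    ultimately show "x \<in> {u, v}" using x J label_sym by force
  qed
  then have "card {y \<in> pverts H. (z, y) \<in> parcs G} \<le> card {u, v}" by (intro card_mono) auto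
  also have "\<dots> \<le> 2" by (simp add: card_insert_le_m1)
  finally show ?thesis .
qed (simp only: card.empty)

text \<open>If the two sides held \<open>Suc k\<close> and \<open>Suc k'\<close> branch vertices,
  then \<open>Suc k * Suc k' = d + k * k'\<close> labels would cross on at most \<open>d\<close>
  arcs. This forces \<open>k * k' = 0\<close> and one label per crossing arc, whereas the path
  \<open>p\<close>, \<open>w'\<close>, \<open>w\<close>, \<open>q\<close>, all of whose edges cross,
  forces two branch vertices on each side.\<close>

lemma branch_one_side:
  assumes card: "card {(x, y). (x, y) \<in> parcs G \<and> x \<in> P \<and> y \<notin> P} \<le> d"
    and P4: "(p, w') \<in> parcs G" "(w, w') \<in> parcs G" "(w, q) \<in> parcs G"
    and sides: "p \<in> P" "w \<in> P" "w' \<notin> P" "q \<notin> P" "p \<noteq> w" "w' \<noteq> q"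
  shows "pverts H \<inter> P = {} \<or> pverts H \<subseteq> P"
proof (rule ccontr)
  assume neg: "\<not> ?thesis"
  let ?D = "{(x, y). (x, y) \<in> parcs G \<and> x \<in> P \<and> y \<notin> P}"
  define D where "D = {(x, y). (x, y) \<in> parcs J \<and> x \<in> P \<and> y \<notin> P}"
  define K K' where "K = pverts H \<inter> P" and "K' = pverts H - P"
  define C where "C = (\<lambda>(u, v). {u, v}) ` (K \<times> K')"
  have fin: "finite K" "finite K'" using branch_finite by (auto simp: K_def K'_def)
  have ne: "card K \<ge> 1" "card K' \<ge> 1"
    using neg fin by (auto simp: K_def K'_def Suc_le_eq card_gt_0_iff)
  have "card K + card K' = card (K \<union> K')"
    using fin by (intro card_Un_disjoint[symmetric]) (auto simp: K_def K'_def)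
  also have "K \<union> K' = pverts H" by (auto simp: K_def K'_def)
  finally have sum: "card K + card K' = d + 1" by (simp add: branch_card)
  obtain k k' where k: "card K = Suc k" "card K' = Suc k'"
    using ne by (metis One_nat_def Suc_le_D)
  have prod: "card K * card K' = d + k * k'" using sum k by (simp add: algebra_simps)
  have "inj_on (\<lambda>(u, v). {u, v}) (K \<times> K')"
    by (auto simp: inj_on_def K_def K'_def doubleton_eq_iff)
  then have cardC: "card C = d + k * k'"
    by (simp add: C_def card_image card_cartesian_product prod)
  have CD: "C \<subseteq> L ` D"
  proof
    fix l assume "l \<in> C"
    then obtain u v where uv: "u \<in> K" "v \<in> K'" "l = {u, v}" by (auto simp: C_def)
    then have "\<exists>x y. (x, y) \<in> parcs J \<and> x \<in> P \<and> y \<notin> P \<and> L (x, y) = {u, v}"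
      by (intro label_cut) (auto simp: K_def K'_def branch_arcs)
    then show "l \<in> L ` D" using uv by (force simp: D_def)
  qed
  have finD: "finite ?D" using finite_arcs_G by (rule rev_finite_subset) auto
  have sub: "D \<subseteq> ?D" using J_arcs by (auto simp: D_def)
  have finD': "finite D" using finD sub by (rule rev_finite_subset)
  have "card C \<le> card (L ` D)" using CD finD' by (intro card_mono) auto
  moreover have "card (L ` D) \<le> card D" using finD' by (rule card_image_le)
  moreover have "card D \<le> card ?D" using finD sub by (rule card_mono)
  \<comment> \<open>Every inequality in the chain is tight: all crossing arcs of \<open>G\<close>
    lie in \<open>J\<close>, and they carry distinct labels.\<close>
  ultimately have cards: "card D = card ?D" "card (L ` D) = card D" "card C = card (L ` D)" "k * k' = 0"
    using card cardC by linarith+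
  have D: "D = ?D" using cards sub finD by (intro card_subset_eq) auto
  have inj: "inj_on L D" using cards finD' by (intro eq_card_imp_inj_on) auto
  have LD: "L ` D = C" using cards CD finD' card_subset_eq[of "L ` D" C] by auto
  have arcs: "(p, w') \<in> D" "(w, w') \<in> D" "(w, q) \<in> D"
    using P4 sides by (auto simp: D)
  have neq: "L (p, w') \<noteq> L (w, w')" "L (w, q) \<noteq> L (w, w')"
    using inj_onD[OF inj] arcs sides by blast+
  have inJ: "(p, w') \<in> parcs J" "(w, w') \<in> parcs J" "(w, q) \<in> parcs J"
    using arcs by (auto simp: D_def)
  \<comment> \<open>Were \<open>w'\<close> not a branch vertex, its two crossing arcs would share a
    label; the same argument is used for \<open>w\<close> below.\<close>
  have "w' \<in> pverts H"
    using neq(1) inJ label_inner[of w' p w] arc_sym[of _ w'] label_sym[of _ w'] by force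
  then have "w' \<in> L (p, w')" "w' \<in> L (w, w')" "w' \<in> K'"
    using inJ label_branch[of w'] arc_sym[of _ w'] label_sym[of _ w'] sides by (auto simp: K'_def)
  moreover have inC: "L (p, w') \<in> C" "L (w, w') \<in> C" "L (w, q) \<in> C" using arcs LD by blast+
  ultimately obtain u1 u2 where "u1 \<in> K" "L (p, w') = {u1, w'}" "u2 \<in> K" "L (w, w') = {u2, w'}"
    by (auto simp: C_def K_def K'_def)
  with neq(1) have u: "u1 \<in> K" "u2 \<in> K" "u1 \<noteq> u2" by auto
  have "w \<in> pverts H"
    using neq(2) inJ label_inner[of w q w'] by blast
  then have "w \<in> L (w, q)" "w \<in> L (w, w')" "w \<in> K"
    using inJ label_branch sides by (auto simp: K_def)
  with inC(2,3)
  obtain v1 v2 where "v1 \<in> K'" "L (w, q) = {w, v1}" "v2 \<in> K'" "L (w, w') = {w, v2}"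
    by (auto simp: C_def K_def K'_def)
  with neq(2) have v: "v1 \<in> K'" "v2 \<in> K'" "v1 \<noteq> v2" by auto
  have "card {u1, u2} \<le> card K" "card {v1, v2} \<le> card K'" using u v fin by (intro card_mono; simp)+
  then have "k \<ge> 1" "k' \<ge> 1" using u v k by auto
  with cards(4) show False by auto
qed

end

lemma contains_complete_subdivisionE:
  assumes "contains_complete_subdivision (d + 1) G" "regular_graph d G"
  obtains H J L where "regular_complete_subdivision H J L G d" "pverts H \<subseteq> pverts G"
proof -
  obtain H J where HJ: "complete_digraph (d + 1) (with_proj H)" "subgraph (with_proj J) (with_proj G)"
      "subdivision_pair H J"
    using assms by (auto simp: contains_complete_subdivision_def contains_subdivision_def)
  obtain L where "pverts H \<subseteq> pverts J" "branch_labelling H J L"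
    using subdivision_pair_labelling[OF HJ(3)] by blast
  then show ?thesis
    using HJ assms by (intro that) (auto simp: subgraph_def regular_complete_subdivision_def
      regular_complete_subdivision_axioms_def)
qed

section \<open>The complement of a tree inside a piece\<close>

declare add_2_eq_Suc [simp del] add_2_eq_Suc' [simp del]

text \<open>Non-adjacency inside a piece: a tree on \<open>{0..d + 1}\<close>, namely the path \<open>0, 1, ..., d - 1\<close> with
  two further leaves \<open>d\<close> and \<open>d + 1\<close> at 0.\<close>

definition gap :: "nat \<Rightarrow> nat \<Rightarrow> nat \<Rightarrow> bool" where
  "gap d a b \<longleftrightarrow> (b = Suc a \<and> b < d) \<or> (a = Suc b \<and> a < d) \<or>
     (a = 0 \<and> (b = d \<or> b = d + 1)) \<or> (b = 0 \<and> (a = d \<or> a = d + 1))"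

lemma gap_sym: "gap d a b \<longleftrightarrow> gap d b a"
  by (auto simp: gap_def)

lemma gap_neighbours:
  assumes "d \<ge> 3"
  shows "{b. gap d a b} =
    (if a = 0 then {1, d, d + 1} else if a < d - 1 then {a - 1, a + 1}
     else if a = d - 1 then {a - 1} else if a = d \<or> a = d + 1 then {0} else {})"
  using assms by (auto simp: gap_def)

text \<open>A tree has no 4-cycle. Let \<open>P\<close> be the parent map of the tree rooted at 0;
  parents are smaller, so both neighbours of the largest vertex on a 4-cycle would be its
  parent.\<close>

lemma gap_no_square:
  assumes "gap d a c" "gap d a e" "gap d b c" "gap d b e" "a \<noteq> b" "d \<ge> 3"
  shows "c = e"
proof -
  define P where "P x = (if x < d then x - 1 else 0)" for x
  have P: "(x = P y \<and> x < y) \<or> (y = P x \<and> y < x)" if "gap d x y" for x y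
    using that assms(6) by (auto simp: gap_def P_def)
  show ?thesis
    using P[OF assms(1)] P[OF assms(2)] P[OF assms(3)] P[OF assms(4)] assms(5)
    by (elim disjE conjE) (linarith | simp)+
qed

text \<open>All pairs between \<open>U\<close> and \<open>T - U\<close> are tree edges. Two vertices
  on both sides would give a 4-cycle, so a nonempty proper \<open>U\<close> or its complement is a
  single vertex with at least three tree neighbours, and only position 0 has that many.\<close>

lemma gap_complete_split:
  assumes d: "d \<ge> 3" and T: "card T \<ge> 4" and U: "U \<subseteq> T"
    and gap: "\<And>a b. a \<in> U \<Longrightarrow> b \<in> T - U \<Longrightarrow> gap d a b"
  shows "U = {} \<or> U = T \<or> (T = {0, 1, d, d + 1} \<and> (U = {0} \<or> U = {1, d, d + 1}))"
proof -
  have fin: "finite T" using T by (intro card_ge_0_finite) simp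
  then have fin': "finite U" using U by (rule rev_finite_subset)
  have star: "a = 0 \<and> W = {1, d, d + 1}" if W: "\<And>b. b \<in> W \<Longrightarrow> gap d a b" "card W \<ge> 3" for a W
  proof -
    have sub: "W \<subseteq> {b. gap d a b}" using W by blast
    have fin: "finite {b. gap d a b}" by (simp add: gap_neighbours[OF d])
    have "3 \<le> card {b. gap d a b}" using card_mono[OF fin sub] W by simp
    then have a: "a = 0"
      using card_insert_le_m1[of 2 "{a + 1}" "a - 1"] by (auto simp: gap_neighbours[OF d] split: if_splits)
    moreover have "{b. gap d a b} = {1, d, d + 1}" using a by (simp add: gap_neighbours[OF d])
    moreover have "card {1, d, d + 1} = 3" using d by simp
    ultimately show ?thesis using card_seteq[OF fin sub] W by simp
  qed
  have card: "card U + card (T - U) = card T"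
    using fin fin' U card_Diff_subset[of U T] card_mono[OF fin U] by simp
  consider "card U = 0" | "card (T - U) = 0" | "card U = 1" | "card (T - U) = 1"
    | "card U \<ge> 2" "card (T - U) \<ge> 2" by linarith
  then show ?thesis
  proof cases
    case 1
    then show ?thesis using fin' by simp
  next
    case 2
    then have "T - U = {}" using fin card_0_eq[of "T - U"] by blast
    then show ?thesis using U by blast
  next
    case 3
    then obtain a where a: "U = {a}" by (auto simp: card_1_singleton_iff)
    have "a = 0 \<and> T - U = {1, d, d + 1}" using a gap 3 card T by (intro star) auto
    then show ?thesis using a U by auto
  next
    case 4
    then obtain a where a: "T - U = {a}" by (auto simp: card_1_singleton_iff)
    have "a = 0 \<and> U = {1, d, d + 1}" using a gap 4 card T gap_sym by (intro star) auto
    moreover have "T = insert a U" using a U by auto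
    ultimately show ?thesis by auto
  next
    case 5
    obtain a b where ab: "a \<in> U" "b \<in> U" "a \<noteq> b" using 5(1) by (metis card_le_Suc0_iff_eq fin' not_less_eq_eq numeral_2_eq_2)
    obtain c e where "c \<in> T - U" "e \<in> T - U" "c \<noteq> e" using 5(2) by (metis card_le_Suc0_iff_eq fin finite_Diff not_less_eq_eq numeral_2_eq_2)
    then show ?thesis using gap_no_square[OF gap gap gap gap, of a c e b] ab d by blast
  qed
qed

section \<open>Graphs assembled from pieces along ports\<close>

text \<open>With this encoding all graphs with \<open>n\<close> pieces share the vertex set
  \<open>{..<n * (d + 2)}\<close>, so they can be counted as labelled graphs.\<close>

definition vx :: "nat \<Rightarrow> nat \<Rightarrow> nat \<Rightarrow> nat" where
  "vx d q k = q * (d + 2) + k"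

lemma vx_div [simp]: "k < d + 2 \<Longrightarrow> vx d q k div (d + 2) = q"
  and vx_mod [simp]: "k < d + 2 \<Longrightarrow> vx d q k mod (d + 2) = k"
  by (simp_all add: vx_def)

lemma vx_div_mod [simp]: "vx d (v div (d + 2)) (v mod (d + 2)) = v"
  by (simp add: vx_def div_mult_mod_eq)

lemma vx_less_iff: "k < d + 2 \<Longrightarrow> vx d q k < n * (d + 2) \<longleftrightarrow> q < n"
  by (metis div_less_iff_less_mult vx_div zero_less_iff_neq_zero not_less_zero)

lemma vx_eq_iff: "\<lbrakk>k < d + 2; k' < d + 2\<rbrakk> \<Longrightarrow> vx d q k = vx d q' k' \<longleftrightarrow> q = q' \<and> k = k'"
  by (metis vx_div vx_mod)

lemma vx_cases:
  assumes "v < n * (d + 2)"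
  obtains q k where "q < n" "k < d + 2" "v = vx d q k"
proof
  show "v div (d + 2) < n" using assms by (simp add: div_less_iff_less_mult)
  show "v mod (d + 2) < d + 2" by simp
qed simp

text \<open>Positions below \<open>d - 1\<close> are ports: port \<open>k\<close> of piece \<open>q\<close> is joined to port \<open>\<rho> k\<close> of piece \<open>\<Phi> k q\<close>.
  The last disjunct adds an edge between the ports 0 of two partner pieces.\<close>

definition piece_adj ::
  "nat \<Rightarrow> (nat \<Rightarrow> nat \<Rightarrow> nat) \<Rightarrow> (nat \<Rightarrow> nat) \<Rightarrow> nat \<Rightarrow> nat \<Rightarrow> nat \<Rightarrow> nat \<Rightarrow> bool" where
  "piece_adj d \<Phi> \<rho> q k q' k' \<longleftrightarrow>
     (q' = q \<and> k' \<noteq> k \<and> \<not> gap d k k') \<or>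
     (k < d - 1 \<and> q' = \<Phi> k q \<and> k' = \<rho> k) \<or>
     (k = 0 \<and> k' = 0 \<and> q' = \<Phi> 0 q)"

definition piece_graph ::
  "nat \<Rightarrow> nat \<Rightarrow> (nat \<Rightarrow> nat \<Rightarrow> nat) \<Rightarrow> (nat \<Rightarrow> nat) \<Rightarrow> nat pair_pre_digraph" where
  "piece_graph d n \<Phi> \<rho> = \<lparr>pverts = {..<n * (d + 2)},
     parcs = {(u, v). u < n * (d + 2) \<and> v < n * (d + 2) \<and>
       piece_adj d \<Phi> \<rho> (u div (d + 2)) (u mod (d + 2)) (v div (d + 2)) (v mod (d + 2))}\<rparr>"

lemma piece_graph_verts [simp]: "pverts (piece_graph d n \<Phi> \<rho>) = {..<n * (d + 2)}"
  by (simp add: piece_graph_def)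

lemma piece_graph_arcs_iff:
  "\<lbrakk>k < d + 2; k' < d + 2\<rbrakk> \<Longrightarrow> (vx d q k, vx d q' k') \<in> parcs (piece_graph d n \<Phi> \<rho>) \<longleftrightarrow>
     q < n \<and> q' < n \<and> piece_adj d \<Phi> \<rho> q k q' k'"
  by (simp add: piece_graph_def vx_less_iff)

lemma piece_graph_arcE:
  assumes "(u, v) \<in> parcs (piece_graph d n \<Phi> \<rho>)"
  obtains q k q' k' where "u = vx d q k" "v = vx d q' k'" "k < d + 2" "k' < d + 2" "q < n" "q' < n"
    "piece_adj d \<Phi> \<rho> q k q' k'"
proof -
  have "u < n * (d + 2)" "v < n * (d + 2)" using assms by (auto simp: piece_graph_def)
  then obtain q k q' k' where "k < d + 2" "u = vx d q k" "k' < d + 2" "v = vx d q' k'"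
    by (metis vx_cases)
  then show ?thesis using assms piece_graph_arcs_iff that by metis
qed

text \<open>The multigraph on the pieces is given by its half-edges \<open>(q, k)\<close> and the
  involution to \<open>(\<Phi> k q, \<rho> k)\<close>, without loops. By \<open>\<rho>_0\<close> and
  \<open>\<Phi>_1\<close>, ports 0 and 1 of a piece lead to ports 1 and 0 of one partner;
  \<open>cut\<close> is edge-connectivity at least \<open>d - 1\<close>.\<close>

locale port_multigraph =
  fixes d n :: nat and \<Phi> :: "nat \<Rightarrow> nat \<Rightarrow> nat" and \<rho> :: "nat \<Rightarrow> nat"
  assumes d: "d \<ge> 5" and n: "n > 0"
    and \<rho>_less: "k < d - 1 \<Longrightarrow> \<rho> k < d - 1"
    and \<rho>_\<rho>: "k < d - 1 \<Longrightarrow> \<rho> (\<rho> k) = k"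
    and \<Phi>_less: "\<lbrakk>k < d - 1; q < n\<rbrakk> \<Longrightarrow> \<Phi> k q < n"
    and \<Phi>_neq: "\<lbrakk>k < d - 1; q < n\<rbrakk> \<Longrightarrow> \<Phi> k q \<noteq> q"
    and \<Phi>_\<rho>: "\<lbrakk>k < d - 1; q < n\<rbrakk> \<Longrightarrow> \<Phi> (\<rho> k) (\<Phi> k q) = q"
    and \<rho>_0: "\<rho> 0 = 1"
    and \<Phi>_1: "q < n \<Longrightarrow> \<Phi> 1 q = \<Phi> 0 q"
    and cut: "\<lbrakk>A \<subseteq> {..<n}; A \<noteq> {}; A \<noteq> {..<n}\<rbrakk> \<Longrightarrow>
      d - 1 \<le> card {(q, k). q \<in> A \<and> k < d - 1 \<and> \<Phi> k q \<notin> A}"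
begin

abbreviation "G \<equiv> piece_graph d n \<Phi> \<rho>"

lemma \<rho>_1: "\<rho> 1 = 0"
  using \<rho>_\<rho>[of 0] d by (simp add: \<rho>_0)

lemma \<Phi>_0_0: "q < n \<Longrightarrow> \<Phi> 0 (\<Phi> 0 q) = q"
  using \<Phi>_\<rho>[of 0 q] \<Phi>_1[of "\<Phi> 0 q"] \<Phi>_less[of 0 q] d by (simp add: \<rho>_0)

lemma piece_adj_sym:
  assumes "q < n" "piece_adj d \<Phi> \<rho> q k q' k'"
  shows "piece_adj d \<Phi> \<rho> q' k' q k"
proof -
  consider "q' = q" "k' \<noteq> k" "\<not> gap d k k'" | "k < d - 1" "q' = \<Phi> k q" "k' = \<rho> k"
    | "k = 0" "k' = 0" "q' = \<Phi> 0 q"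
    using assms(2) unfolding piece_adj_def by blast
  then show ?thesis
  proof cases
    case 1
    then show ?thesis using gap_sym unfolding piece_adj_def by blast
  next
    case 2
    then show ?thesis using \<rho>_less \<rho>_\<rho> \<Phi>_\<rho> assms(1) unfolding piece_adj_def by simp
  next
    case 3
    then show ?thesis using \<Phi>_0_0 assms(1) unfolding piece_adj_def by simp
  qed
qed

lemma pair_graph_G: "pair_graph G"
proof
  fix e assume "e \<in> parcs G"
  then show "fst e \<in> pverts G" "snd e \<in> pverts G" by (auto simp: piece_graph_def)
  show "fst e \<noteq> snd e"
  proof -
    obtain q k q' k' where "e = (vx d q k, vx d q' k')" "k < d + 2" "k' < d + 2" "q < n"
      "piece_adj d \<Phi> \<rho> q k q' k'"
      using \<open>e \<in> parcs G\<close> by (cases e) (blast elim: piece_graph_arcE)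
    then show ?thesis using \<Phi>_neq[of k q] \<Phi>_neq[of 0 q] d
      by (auto simp: vx_eq_iff piece_adj_def)
  qed
next
  show "finite (pverts G)" by simp
  show "finite (parcs G)"
    by (rule finite_subset[of _ "{..<n * (d + 2)} \<times> {..<n * (d + 2)}"]) (auto simp: piece_graph_def)
  show "symmetric (with_proj G)"
    unfolding symmetric_def with_proj_simps
  proof (rule symI)
    fix u v assume "(u, v) \<in> parcs G"
    then obtain q k q' k' where "u = vx d q k" "v = vx d q' k'" "k < d + 2" "k' < d + 2"
      "q < n" "q' < n" "piece_adj d \<Phi> \<rho> q k q' k'"
      by (rule piece_graph_arcE)
    then show "(v, u) \<in> parcs G" using piece_adj_sym by (simp add: piece_graph_arcs_iff)
  qed
qed

definition inner :: "nat \<Rightarrow> nat set" where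
  "inner k = {k'. k' < d + 2 \<and> k' \<noteq> k \<and> \<not> gap d k k'}"

lemma card_inner:
  assumes "k < d + 2"
  shows "card (inner k) = (if k = 0 then d - 2 else if k < d - 1 then d - 1 else d)"
proof -
  have "inner k = {..<d + 2} - insert k {k'. gap d k k'}" by (auto simp: inner_def)
  moreover have "insert k {k'. gap d k k'} \<subseteq> {..<d + 2}"
    using assms d by (auto simp: gap_def)
  ultimately have "card (inner k) = d + 2 - card (insert k {k'. gap d k k'})"
    by (metis card_Diff_subset card_lessThan finite_lessThan finite_subset)
  also have "card (insert k {k'. gap d k k'}) = (if k = 0 then 4 else if k < d - 1 then 3 else 2)"
    using assms d by (auto simp: gap_neighbours)
  finally show ?thesis using d by auto
qed

definition outer :: "nat \<Rightarrow> nat \<Rightarrow> nat set" where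
  "outer q k = (if k < d - 1 then {vx d (\<Phi> k q) (\<rho> k)} else {}) \<union> (if k = 0 then {vx d (\<Phi> 0 q) 0} else {})"

lemma neighbours:
  assumes "q < n" "k < d + 2"
  shows "{v. (vx d q k, v) \<in> parcs G} = vx d q ` inner k \<union> outer q k"
proof (intro equalityI subsetI)
  fix v assume "v \<in> {v. (vx d q k, v) \<in> parcs G}"
  then show "v \<in> vx d q ` inner k \<union> outer q k"
    using assms by (auto simp: vx_eq_iff piece_adj_def inner_def outer_def elim!: piece_graph_arcE)
next
  fix v assume "v \<in> vx d q ` inner k \<union> outer q k"
  then show "v \<in> {v. (vx d q k, v) \<in> parcs G}"
    using assms \<rho>_less[of k] \<Phi>_less[of k q] \<Phi>_less[of 0 q] d
    by (auto simp: inner_def outer_def piece_graph_arcs_iff piece_adj_def split: if_splits)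
qed

text \<open>A position of degree \<open>t\<close> in the tree has \<open>d + 1 - t\<close>
  neighbours in its piece and \<open>t - 1\<close> outside: two at position 0, one at each other
  port, none at the three leaves.\<close>

lemma regular_G: "regular_graph d G"
  unfolding regular_graph_def
proof (intro conjI ballI pair_graph_G)
  fix v assume "v \<in> pverts G"
  then obtain q k where v: "q < n" "k < d + 2" "v = vx d q k" by (auto elim: vx_cases)
  have "out_arcs (with_proj G) v = Pair v ` {w. (v, w) \<in> parcs G}"
    by (auto simp: out_arcs_def)
  then have "out_degree (with_proj G) v = card (vx d q ` inner k \<union> outer q k)"
    by (simp add: out_degree_def card_image inj_on_def v neighbours)
  also have "\<dots> = card (vx d q ` inner k) + card (outer q k)"
  proof (rule card_Un_disjoint)
    show "vx d q ` inner k \<inter> outer q k = {}"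
      using v \<Phi>_neq[of k q] \<Phi>_neq[of 0 q] \<rho>_less[of k] d
      by (auto simp: outer_def inner_def vx_eq_iff split: if_splits)
  qed (auto simp: outer_def inner_def)
  also have "card (vx d q ` inner k) = card (inner k)"
    by (rule card_image) (auto simp: inj_on_def vx_def)
  also have "card (outer q k) = (if k = 0 then 2 else if k < d - 1 then 1 else 0)"
    using d by (auto simp: outer_def \<rho>_0 vx_eq_iff)
  finally show "out_degree (with_proj G) v = d"
    using d by (simp add: card_inner v)
qed

text \<open>All \<open>d + 1\<close> branch vertices lie in the piece of one of them. The one vertex
  left over in that piece has at least \<open>d - 2\<close> neighbours there, all of them branch
  vertices, which is more than the two allowed.\<close>

lemma no_complete_subdivision: "\<not> contains_complete_subdivision (d + 1) G"
proof
  assume "contains_complete_subdivision (d + 1) G"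
  then obtain H J L where "regular_complete_subdivision H J L G d" and sub: "pverts H \<subseteq> pverts G"
    using regular_G by (rule contains_complete_subdivisionE)
  then interpret regular_complete_subdivision H J L G d by simp
  obtain b where b: "b \<in> pverts H" using branch_card by fastforce
  then have "b < n * (d + 2)" using sub by auto
  then obtain q k where q: "q < n" "k < d + 2" "b = vx d q k" by (rule vx_cases)
  let ?P = "vx d q ` {..<d + 2}"
  have finP: "finite ?P" by simp
  have cardP: "card ?P = d + 2" by (subst card_image) (auto simp: inj_on_def vx_def)
  have "pverts H \<inter> ?P = {} \<or> pverts H \<subseteq> ?P"
  proof (rule branch_one_side)
    let ?D = "{(x, y). (x, y) \<in> parcs G \<and> x \<in> ?P \<and> y \<notin> ?P}"
    \<comment> \<open>The additional edge between ports 0, followed by the \<open>d - 1\<close> port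
      edges.\<close>
    let ?E = "insert (vx d q 0, vx d (\<Phi> 0 q) 0) ((\<lambda>k. (vx d q k, vx d (\<Phi> k q) (\<rho> k))) ` {..<d - 1})"
    have "?D \<subseteq> ?E"
      by (auto simp: vx_eq_iff piece_adj_def elim!: piece_graph_arcE)
    then have "card ?D \<le> card ?E" by (intro card_mono) auto
    also have "\<dots> \<le> Suc (card ((\<lambda>k. (vx d q k, vx d (\<Phi> k q) (\<rho> k))) ` {..<d - 1}))"
      by (rule card_insert_le_m1[of "Suc _", simplified]) simp
    also have "\<dots> \<le> Suc (d - 1)" using card_image_le[of "{..<d - 1}"] by simp
    finally show "card ?D \<le> d" using d by simp
    have q': "\<Phi> 0 q < n" "\<Phi> 0 q \<noteq> q" using \<Phi>_less[of 0 q] \<Phi>_neq[of 0 q] q d by auto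
    \<comment> \<open>The path visits port 1 of \<open>q\<close>, port 0 of the partner, port 0 of
      \<open>q\<close> and port 1 of the partner.\<close>
    show "(vx d q 1, vx d (\<Phi> 0 q) 0) \<in> parcs G" "(vx d q 0, vx d (\<Phi> 0 q) 0) \<in> parcs G"
        "(vx d q 0, vx d (\<Phi> 0 q) 1) \<in> parcs G"
      using q q' d \<Phi>_1 \<rho>_0 \<rho>_1 by (simp_all add: piece_graph_arcs_iff piece_adj_def)
    show "vx d q 1 \<in> ?P" "vx d q 0 \<in> ?P" "vx d (\<Phi> 0 q) 0 \<notin> ?P" "vx d (\<Phi> 0 q) 1 \<notin> ?P"
        "vx d q 1 \<noteq> vx d q 0" "vx d (\<Phi> 0 q) 0 \<noteq> vx d (\<Phi> 0 q) 1"
      using q' by (auto simp: vx_eq_iff)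
  qed
  then have BP: "pverts H \<subseteq> ?P" using b q by auto
  then have "card (?P - pverts H) = 1"
    using cardP branch_card branch_finite by (simp add: card_Diff_subset)
  then obtain z where z: "?P - pverts H = {z}" by (auto simp: card_1_singleton_iff)
  then have "z \<in> ?P" "z \<notin> pverts H" by blast+
  then obtain k where k: "k < d + 2" "z = vx d q k" by auto
  have "vx d q ` inner k \<subseteq> {y \<in> pverts H. (z, y) \<in> parcs G}"
  proof
    fix y assume "y \<in> vx d q ` inner k"
    then obtain k' where k': "y = vx d q k'" "k' \<in> inner k" by blast
    then have "k' < d + 2" "k' \<noteq> k" by (auto simp: inner_def)
    then have "y \<in> ?P" "y \<noteq> z" using k' k by (auto simp: vx_eq_iff)
    then have "y \<in> pverts H" using z by blast
    moreover have "(z, y) \<in> parcs G" using neighbours[OF q(1) k(1)] k' k by blast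
    ultimately show "y \<in> {y \<in> pverts H. (z, y) \<in> parcs G}" by simp
  qed
  then have "card (vx d q ` inner k) \<le> card {y \<in> pverts H. (z, y) \<in> parcs G}"
    using branch_finite by (intro card_mono) auto
  also have "\<dots> \<le> 2" using \<open>z \<notin> pverts H\<close> by (rule inner_vertex_branch_neighbours)
  also have "card (vx d q ` inner k) = card (inner k)"
    by (rule card_image) (auto simp: inj_on_def vx_def)
  finally show False using d k by (simp add: card_inner split: if_splits)
qed

end

section \<open>Vertex connectivity of the piece graphs\<close>

text \<open>The set reachable from a vertex of \<open>S\<close> is nonempty and closed under
  adjacency in \<open>S\<close>, so by \<open>split\<close> it is all of \<open>S\<close>. Passing
  to \<open>mk_symmetric\<close> adds no arcs, as \<open>G\<close> is symmetric.\<close>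

lemma connected_induce_subgraphI:
  fixes G :: "'a pair_pre_digraph"
  assumes "pair_graph G" "S \<subseteq> pverts G" "S \<noteq> {}"
    and split: "\<And>U. \<lbrakk>U \<subseteq> S; U \<noteq> {}; \<And>x y. x \<in> U \<Longrightarrow> y \<in> S - U \<Longrightarrow> (x, y) \<notin> parcs G\<rbrakk> \<Longrightarrow> U = S"
  shows "Digraph_Component.connected (with_proj G \<restriction> S)"
proof -
  interpret G: pair_graph G by fact
  let ?H = "mk_symmetric (with_proj G \<restriction> S)"
  have arcs: "parcs ?H = {(x, y). (x, y) \<in> parcs G \<and> x \<in> S \<and> y \<in> S}"
    using G.arcs_symmetric by (auto simp: mk_symmetric_def)
  have verts: "pverts ?H = S" by (simp add: mk_symmetric_def)
  have wf: "wf_digraph (with_proj ?H)" by unfold_locales (auto simp: verts arcs)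
  have reach: "u \<rightarrow>\<^sup>*\<^bsub>with_proj ?H\<^esub> v" if "u \<in> S" "v \<in> S" for u v
  proof -
    let ?U = "{v \<in> S. u \<rightarrow>\<^sup>*\<^bsub>with_proj ?H\<^esub> v}"
    have "?U = S"
    proof (rule split)
      show "?U \<noteq> {}" using that verts by (auto intro!: wf_digraph.reachable_refl[OF wf])
      fix x y assume xy: "x \<in> ?U" "y \<in> S - ?U"
      show "(x, y) \<notin> parcs G"
      proof
        assume "(x, y) \<in> parcs G"
        then have "(x, y) \<in> arcs_ends (with_proj ?H)" using xy arcs by auto
        then have "u \<rightarrow>\<^sup>*\<^bsub>with_proj ?H\<^esub> y"
          using xy wf_digraph.reachable_adj_trans[OF wf] by blast
        then show False using xy by blast
      qed
    qed auto
    then show ?thesis using that by blast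
  qed
  show ?thesis
    unfolding connected_def strongly_connected_def using reach verts assms(3) by simp
qed

context port_multigraph
begin

text \<open>Every piece minus the cut \<open>X\<close> lies on one side of a separation, with one exception: \<open>X\<close> may
  consist of all neighbours of position 0 inside its piece, and then position 0 is still joined to
  the partner piece. Colouring the pieces by their side, every boundary edge of the colour class
  \<open>A\<close> has a blocked end. The port edges form a matching, so there are at most \<open>card X\<close> of them; in
  the exceptional case position 0 counts as blocked, but \<open>X\<close> wastes a vertex on \<open>d - 1\<close>, which is not
  a port.\<close>

lemma separation_trivial:
  assumes X: "X \<subseteq> {..<n * (d + 2)}" "card X < d - 1"
    and U: "U \<subseteq> {..<n * (d + 2)} - X"
    and sep: "\<And>x y. x \<in> U \<Longrightarrow> y \<in> {..<n * (d + 2)} - X - U \<Longrightarrow> (x, y) \<notin> parcs G"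
  shows "U = {} \<or> U = {..<n * (d + 2)} - X"
proof -
  define T where "T q = {k. k < d + 2 \<and> vx d q k \<notin> X}" for q
  define W where "W q = {k \<in> T q. vx d q k \<in> U}" for q
  define exc where "exc q \<longleftrightarrow> T q = {0, 1, d, d + 1}" for q
  \<comment> \<open>Position 0 is ignored in this colouring, since in an exceptional piece it may
    lie on the other side from the rest.\<close>
  define A where "A = {q. q < n \<and> (\<exists>k \<in> T q. k \<noteq> 0 \<and> vx d q k \<in> U)}"
  have finX: "finite X" using X(1) by (rule finite_subset) simp
  have same: "vx d q k \<in> U \<longleftrightarrow> vx d q' k' \<in> U"
    if "q < n" "q' < n" "k \<in> T q" "k' \<in> T q'" "piece_adj d \<Phi> \<rho> q k q' k'" for q k q' k'
  proof -
    have k: "k < d + 2" "k' < d + 2" "vx d q k \<notin> X" "vx d q' k' \<notin> X" using that by (auto simp: T_def)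
    then have "(vx d q k, vx d q' k') \<in> parcs G" "(vx d q' k', vx d q k) \<in> parcs G"
      using that piece_adj_sym by (simp_all add: piece_graph_arcs_iff)
    moreover have "vx d q k < n * (d + 2)" "vx d q' k' < n * (d + 2)"
      using that k by (simp_all add: vx_less_iff)
    ultimately show ?thesis using sep[of "vx d q k" "vx d q' k'"] sep[of "vx d q' k'" "vx d q k"] k by auto
  qed
  have Xq: "card (vx d q ` ({..<d + 2} - T q)) = d + 2 - card (T q)" "vx d q ` ({..<d + 2} - T q) \<subseteq> X"
    "card (T q) \<ge> 4" for q
  proof -
    have sub: "T q \<subseteq> {..<d + 2}" by (auto simp: T_def)
    have "card (vx d q ` ({..<d + 2} - T q)) = card ({..<d + 2} - T q)"
      by (rule card_image) (auto simp: inj_on_def vx_def)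
    also have "\<dots> = d + 2 - card (T q)" using sub by (simp add: card_Diff_subset finite_subset)
    finally show 1: "card (vx d q ` ({..<d + 2} - T q)) = d + 2 - card (T q)" .
    show 2: "vx d q ` ({..<d + 2} - T q) \<subseteq> X" by (auto simp: T_def)
    show "card (T q) \<ge> 4" using card_mono[OF finX 2] 1 X(2) d by simp
  qed
  have split: "W q = {} \<or> W q = T q \<or> (exc q \<and> (W q = {0} \<or> W q = {1, d, d + 1}))" if "q < n" for q
    unfolding exc_def
  proof (rule gap_complete_split)
    fix a b assume ab: "a \<in> W q" "b \<in> T q - W q"
    then have "\<not> piece_adj d \<Phi> \<rho> q a q b" using same[of q q a b] that by (auto simp: W_def)
    then show "gap d a b" using ab by (auto simp: piece_adj_def)
  qed (use d Xq in \<open>auto simp: W_def\<close>)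
  have in_A: "vx d q k \<in> U \<longleftrightarrow> q \<in> A" if q: "q < n" and kT: "k \<in> T q" and "k \<noteq> 0 \<or> \<not> exc q" for q k
  proof -
    have W: "k \<in> W q \<longleftrightarrow> vx d q k \<in> U" using that by (simp add: W_def)
    have A: "q \<in> A \<longleftrightarrow> (\<exists>k \<in> W q. k \<noteq> 0)" using that(1) by (auto simp: A_def W_def)
    have "T q - {0} \<noteq> {}"
    proof
      assume "T q - {0} = {}"
      then have "card (T q) \<le> card {0 :: nat}" by (intro card_mono) auto
      then show False using Xq(3)[of q] by simp
    qed
    then obtain k0 where k0: "k0 \<in> T q" "k0 \<noteq> 0" by blast
    consider "W q = {}" | "W q = T q" | "exc q" "W q = {0}" | "exc q" "W q = {1, d, d + 1}"
      using split[OF q] by blast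
    then have "k \<in> W q \<longleftrightarrow> (\<exists>k \<in> W q. k \<noteq> 0)"
    proof cases
      case 2
      then show ?thesis using k0 that(2) by blast
    next
      case 3
      then show ?thesis using that(3) by simp
    next
      case 4
      then show ?thesis using that(2,3) unfolding exc_def by simp
    qed simp
    then show ?thesis using W A by simp
  qed
  \<comment> \<open>An exceptional piece has lost \<open>d - 2\<close> positions, which exhausts
    \<open>X\<close>; every other piece is therefore intact.\<close>
  have exc_X: "X = vx d q ` {2..<d}" if "exc q" for q
  proof -
    have T: "{..<d + 2} - T q = {2..<d}" using that d by (auto simp: exc_def)
    have "card (vx d q ` {2..<d}) = d - 2"
      by (subst card_image) (auto simp: inj_on_def vx_def)
    then show ?thesis using card_seteq[OF finX Xq(2)[of q]] T X(2) by simp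
  qed
  have exc_other: "T q' = {..<d + 2}" "\<not> exc q'" if "exc q" "q' \<noteq> q" for q q'
  proof -
    show 1: "T q' = {..<d + 2}" using exc_X[OF that(1)] that(2) by (auto simp: T_def vx_eq_iff)
    have "2 \<in> T q'" unfolding 1 using d by simp
    then show "\<not> exc q'" using d by (auto simp: exc_def)
  qed
  have colour: "\<exists>q' < n. v \<in> U \<longleftrightarrow> q' \<in> A" if "v \<in> {..<n * (d + 2)} - X" for v
  proof -
    have "v < n * (d + 2)" using that by simp
    then obtain q k where v: "q < n" "k < d + 2" "v = vx d q k" by (rule vx_cases)
    then have k: "k \<in> T q" using that by (simp add: T_def)
    show ?thesis
    proof (cases "k \<noteq> 0 \<or> \<not> exc q")
      case True
      then show ?thesis using in_A v k by blast
    next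
      case False
      \<comment> \<open>Position 0 of the exceptional piece keeps its edge to port 0 of the intact
        partner and takes the colour of that piece.\<close>
      let ?q = "\<Phi> 0 q"
      have q': "?q < n" "?q \<noteq> q" using v d \<Phi>_less \<Phi>_neq by auto
      then have "0 \<in> T ?q" "\<not> exc ?q" using exc_other False by auto
      moreover have "v \<in> U \<longleftrightarrow> vx d ?q 0 \<in> U"
        using v(3) False same[OF v(1) q'(1) k \<open>0 \<in> T ?q\<close>] by (simp add: piece_adj_def)
      ultimately show ?thesis using in_A[of ?q 0] q' by blast
    qed
  qed
  have "A = {} \<or> A = {..<n}"
  proof (rule ccontr)
    assume "\<not> ?thesis"
    moreover have "A \<subseteq> {..<n}" by (auto simp: A_def)
    ultimately have cutA: "d - 1 \<le> card {(q, k). q \<in> A \<and> k < d - 1 \<and> \<Phi> k q \<notin> A}" (is "_ \<le> card ?D")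
      using cut by blast
    define bad where "bad q k \<longleftrightarrow> k \<notin> T q \<or> (k = 0 \<and> exc q)" for q k
    define Y where "Y = (\<lambda>(q, k). vx d q k) ` {(q, k). q < n \<and> k < d - 1 \<and> bad q k}"
    \<comment> \<open>A port edge leaving \<open>A\<close> is charged to its end inside
      \<open>A\<close> if that is blocked, and otherwise to its other end.\<close>
    define f where "f = (\<lambda>(q, k). if bad q k then vx d q k else vx d (\<Phi> k q) (\<rho> k))"
    have finY: "finite Y"
      unfolding Y_def by (rule finite_imageI, rule finite_subset[of _ "{..<n} \<times> {..<d - 1}"]) auto
    have cardY: "card Y \<le> d - 2"
    proof (cases "\<exists>q < n. exc q")
      case True
      then obtain q where q: "q < n" "exc q" by blast
      have "Y \<subseteq> insert (vx d q 0) (vx d q ` {2..<d - 1})"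
      proof
        fix y assume "y \<in> Y"
        then obtain q' k where y: "y = vx d q' k" "q' < n" "k < d - 1" "bad q' k" by (auto simp: Y_def)
        then have "q' = q" using exc_other[OF q(2), of q'] d by (auto simp: bad_def)
        then have "k \<noteq> 1" using q y by (auto simp: bad_def exc_def)
        then show "y \<in> insert (vx d q 0) (vx d q ` {2..<d - 1})"
          using y \<open>q' = q\<close> by (cases "k = 0") auto
      qed
      then have "card Y \<le> card (insert (vx d q 0) (vx d q ` {2..<d - 1}))" by (intro card_mono) auto
      also have "\<dots> \<le> Suc (card (vx d q ` {2..<d - 1}))" by (simp add: card_insert_if) 
      also have "\<dots> \<le> Suc (card {2..<d - 1})" using card_image_le[of "{2..<d - 1}"] by blast
      finally show ?thesis using d by simp
    next
      case False
      then have "Y \<subseteq> X" by (auto simp: Y_def bad_def T_def)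
      then have "card Y \<le> card X" using finX by (rule card_mono[rotated])
      then show ?thesis using X by simp
    qed
    have fD: "f ` ?D \<subseteq> Y"
    proof
      fix y assume "y \<in> f ` ?D"
      then obtain q k where qk: "y = f (q, k)" "q \<in> A" "k < d - 1" "\<Phi> k q \<notin> A" by auto
      have q: "q < n" using qk by (simp add: A_def)
      show "y \<in> Y"
      proof (cases "bad q k")
        case True
        then show ?thesis using qk q by (auto simp: f_def Y_def)
      next
        case good: False
        have "bad (\<Phi> k q) (\<rho> k)"
        proof (rule ccontr)
          assume good': "\<not> bad (\<Phi> k q) (\<rho> k)"
          have "vx d q k \<in> U \<longleftrightarrow> vx d (\<Phi> k q) (\<rho> k) \<in> U"
            using good good' q qk(3) \<Phi>_less by (intro same) (auto simp: bad_def piece_adj_def)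
          then show False
            using in_A[of q k] in_A[of "\<Phi> k q" "\<rho> k"] good good' q qk \<Phi>_less by (auto simp: bad_def)
        qed
        then show ?thesis using good qk q \<Phi>_less \<rho>_less by (auto simp: f_def Y_def)
      qed
    qed
    have inj: "inj_on f ?D"
    proof (rule inj_onI, clarify)
      fix q k q' k' assume *: "q \<in> A" "k < d - 1" "\<Phi> k q \<notin> A" "q' \<in> A" "k' < d - 1" "\<Phi> k' q' \<notin> A"
        and eq: "f (q, k) = f (q', k')"
      have less: "q < n" "q' < n" "\<rho> k < d - 1" "\<rho> k' < d - 1" using * \<rho>_less by (auto simp: A_def)
      show "q = q' \<and> k = k'"
      proof (cases "bad q k \<longleftrightarrow> bad q' k'")
        case True
        have "(q = q' \<and> k = k') \<or> (\<Phi> k q = \<Phi> k' q' \<and> \<rho> k = \<rho> k')"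
          using True eq * less by (auto simp: f_def vx_eq_iff split: if_splits)
        then show ?thesis
        proof
          assume e: "\<Phi> k q = \<Phi> k' q' \<and> \<rho> k = \<rho> k'"
          have "k = k'" using e \<rho>_\<rho>[OF *(2)] \<rho>_\<rho>[OF *(5)] by metis
          moreover have "q = q'" using e \<Phi>_\<rho>[OF *(2) less(1)] \<Phi>_\<rho>[OF *(5) less(2)] by metis
          ultimately show ?thesis by simp
        qed
      next
        case False
        \<comment> \<open>One charged end lies in a piece of \<open>A\<close>, the other in a piece
          outside \<open>A\<close>.\<close>
        then show ?thesis using eq * less by (auto simp: f_def vx_eq_iff split: if_splits)
      qed
    qed
    have "card ?D \<le> card Y" using card_inj_on_le[OF inj fD finY] .
    then show False using cutA cardY d by linarith
  qed
  then show ?thesis using colour U by fastforce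
qed

lemma k_connected_G: "k_connected (d - 1) G"
  unfolding k_connected_def
proof (intro conjI allI impI pair_graph_G)
  have card: "card (pverts G) \<ge> d + 2" using n by simp
  then show "d - 1 < card (pverts G)" by linarith
  fix X assume X: "X \<subseteq> pverts G" "card X < d - 1"
  show "Digraph_Component.connected (with_proj G \<restriction> (pverts G - X))"
  proof (rule connected_induce_subgraphI[OF pair_graph_G])
    show "pverts G - X \<noteq> {}"
    proof
      assume "pverts G - X = {}"
      then have "pverts G = X" using X by blast
      then have "d + 2 \<le> card X" using card by (rule subst)
      then show False using X(2) by linarith
    qed
    fix U assume "U \<subseteq> pverts G - X" "U \<noteq> {}" "\<And>x y. x \<in> U \<Longrightarrow> y \<in> pverts G - X - U \<Longrightarrow> (x, y) \<notin> parcs G"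
    then show "U = pverts G - X" using separation_trivial[of X U] X by (simp only: piece_graph_verts) blast
  qed auto
qed

end

section \<open>Isomorphism classes of labelled graphs\<close>

lemma digraph_iso_refl:
  assumes "wf_digraph G"
  shows "digraph_iso G G"
  unfolding digraph_iso_def
proof (intro exI conjI)
  let ?f = "\<lparr>iso_verts = id, iso_arcs = id, iso_head = head G, iso_tail = tail G\<rparr>"
  show "pre_digraph.digraph_isomorphism G ?f"
    using assms by (simp add: pre_digraph.digraph_isomorphism_def)
  show "G = app_iso ?f G" by (simp add: app_iso_def)
qed

text \<open>A \<open>digraph_iso\<close> comes with a separate map on arcs. Both graphs have
  \<open>fst\<close> and \<open>snd\<close> as tail and head, so this map is the one induced by the
  vertex map.\<close>

lemma digraph_iso_pairE:
  assumes "digraph_iso (with_proj G) (with_proj H)"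
  obtains \<phi> where "inj_on \<phi> (pverts G)" "pverts H = \<phi> ` pverts G"
    "parcs H = (\<lambda>(x, y). (\<phi> x, \<phi> y)) ` parcs G"
proof -
  from assms obtain f where f: "pre_digraph.digraph_isomorphism (with_proj G) f"
      and H: "with_proj H = app_iso f (with_proj G)"
    unfolding digraph_iso_def by blast
  have sel: "pverts H = iso_verts f ` pverts G" "parcs H = iso_arcs f ` parcs G"
    "fst = iso_tail f" "snd = iso_head f"
    using arg_cong[OF H, of verts] arg_cong[OF H, of arcs] arg_cong[OF H, of tail] arg_cong[OF H, of head]
    by simp_all
  have "iso_arcs f (x, y) = (iso_verts f x, iso_verts f y)" if "(x, y) \<in> parcs G" for x y
    using f that sel(3,4) by (metis fst_conv pre_digraph.iso_verts_head pre_digraph.iso_verts_tail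
        prod.collapse snd_conv with_proj_simps(2,4,5))
  then have "parcs H = (\<lambda>(x, y). (iso_verts f x, iso_verts f y)) ` parcs G"
    unfolding sel(2) by (intro image_cong) auto
  moreover have "inj_on (iso_verts f) (pverts G)"
    using f by (simp add: pre_digraph.digraph_isomorphism_def)
  ultimately show ?thesis using sel(1) that by blast
qed

text \<open>An isomorphism onto \<open>G0\<close> embeds the connected skeleton \<open>F\<close> into \<open>G0\<close>, and such an embedding is
  determined by the image of \<open>r\<close> and, for each arc of \<open>F\<close>, a choice among \<open>d\<close> neighbours.\<close>

lemma card_isomorphic_copies:
  fixes F :: "'a rel" and d :: nat
  assumes skeleton: "\<And>G. G \<in> \<L> \<Longrightarrow> pair_graph G \<and> pverts G = V \<and> F \<subseteq> parcs G"
    and r: "r \<in> V" "\<And>v. v \<in> V \<Longrightarrow> (r, v) \<in> F\<^sup>*"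
    and G0: "G0 \<in> \<L>" "regular_graph d G0"
  shows "card {G \<in> \<L>. digraph_iso (with_proj G) (with_proj G0)} \<le> card V * d ^ (d * card V)"
proof -
  interpret G0: pair_graph G0 using skeleton G0(1) by blast
  have V: "pverts G0 = V" using skeleton G0(1) by blast
  have finV: "finite V" using G0.pair_finite_verts V by simp
  define N where "N x = {y. (x, y) \<in> parcs G0}" for x
  have N_arcs: "out_arcs (with_proj G0) x = Pair x ` N x" for x by (auto simp: out_arcs_def N_def)
  have card_N: "card (N x) = d" if "x \<in> V" for x
  proof -
    have "card (N x) = card (Pair x ` N x)" by (simp add: card_image inj_on_def)
    then show ?thesis
      using G0(2) that V by (simp add: regular_graph_def out_degree_def N_arcs[symmetric])
  qed
  have fin_N: "finite (N x)" for x
    by (rule finite_subset[of _ "V"]) (use finV V G0.wellformed' in \<open>auto simp: N_def\<close>)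
  \<comment> \<open>The neighbours of each vertex are numbered below \<open>d\<close>, so that a
    choice among them can be recorded without naming the vertex.\<close>
  have "\<exists>e. inj_on e (N x) \<and> e ` N x \<subseteq> {..<d}" if "x \<in> V" for x
    using fin_N card_N[OF that] ex_bij_betw_finite_nat[OF fin_N, of x]
    by (metis atLeast0LessThan bij_betw_def order_refl)
  then obtain e where e: "\<And>x. x \<in> V \<Longrightarrow> inj_on (e x) (N x)" "\<And>x. x \<in> V \<Longrightarrow> e x ` N x \<subseteq> {..<d}"
    by metis
  have FG0: "F \<subseteq> parcs G0" using skeleton G0(1) by blast
  have "parcs G0 = (SIGMA x:V. N x)" using V G0.wellformed' by (auto simp: N_def)
  then have "card (parcs G0) = card V * d" using card_N fin_N finV by (simp add: card_SigmaI)
  then have card_F: "card F \<le> d * card V"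
    using card_mono[OF G0.pair_finite_arcs FG0] by (simp add: mult.commute)
  have finF: "finite F" using FG0 G0.pair_finite_arcs by (rule finite_subset)
  let ?C = "{G \<in> \<L>. digraph_iso (with_proj G) (with_proj G0)}"
  define iso where "iso \<phi> G \<longleftrightarrow> inj_on \<phi> V \<and> V = \<phi> ` V \<and>
    parcs G0 = (\<lambda>(x, y). (\<phi> x, \<phi> y)) ` parcs G" for \<phi> :: "'a \<Rightarrow> 'a" and G :: "'a pair_pre_digraph"
  have ex: "\<exists>\<phi>. iso \<phi> G" if "G \<in> ?C" for G
  proof -
    have *: "digraph_iso (with_proj G) (with_proj G0)" "pverts G = V" using that skeleton by auto
    show ?thesis by (rule digraph_iso_pairE[OF *(1)]) (use * V in \<open>auto simp: iso_def\<close>)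
  qed
  define \<phi> where "\<phi> G = (SOME \<phi>. iso \<phi> G)" for G
  have \<phi>: "inj_on (\<phi> G) V \<and> V = \<phi> G ` V \<and> parcs G0 = (\<lambda>(x, y). (\<phi> G x, \<phi> G y)) ` parcs G"
    if "G \<in> ?C" for G
  proof -
    have "iso (\<phi> G) G" unfolding \<phi>_def using ex[OF that] by (rule someI_ex)
    then show ?thesis by (simp only: iso_def)
  qed
  have F_image: "\<phi> G v \<in> N (\<phi> G u)" if "G \<in> ?C" "(u, v) \<in> F" for G u v
  proof -
    have "(u, v) \<in> parcs G" using skeleton[of G] that by blast
    moreover have "parcs G0 = (\<lambda>(x, y). (\<phi> G x, \<phi> G y)) ` parcs G" using \<phi>[OF that(1)] by blast
    ultimately show ?thesis by (auto simp: N_def)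
  qed
  have in_V: "\<phi> G v \<in> V" if "G \<in> ?C" "v \<in> V" for G v using \<phi>[OF that(1)] that(2) by blast
  have F_V: "u \<in> V" "v \<in> V" if "(u, v) \<in> F" for u v using that FG0 V G0.wellformed' by auto
  define code where "code G = (\<phi> G r, \<lambda>(u, v) \<in> F. e (\<phi> G u) (\<phi> G v))" for G
  have code_sub: "code ` ?C \<subseteq> V \<times> (F \<rightarrow>\<^sub>E {..<d})"
  proof
    fix c assume "c \<in> code ` ?C"
    then obtain G where G: "G \<in> ?C" "c = code G" by blast
    have "e (\<phi> G u) (\<phi> G v) \<in> {..<d}" if "(u, v) \<in> F" for u v
      using e(2)[OF in_V[OF G(1) F_V(1)[OF that]]] F_image[OF G(1) that] by blast
    then show "c \<in> V \<times> (F \<rightarrow>\<^sub>E {..<d})"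
      using in_V[OF G(1) r(1)] unfolding G(2) code_def by (auto simp: PiE_def Pi_def extensional_def)
  qed
  have inj_code: "inj_on code ?C"
  proof (rule inj_onI)
    fix G G' assume G: "G \<in> ?C" "G' \<in> ?C" "code G = code G'"
    have root: "\<phi> G r = \<phi> G' r" using G(3) by (simp add: code_def)
    have same_index: "e (\<phi> G u) (\<phi> G v) = e (\<phi> G' u) (\<phi> G' v)" if "(u, v) \<in> F" for u v
    proof -
      have "(\<lambda>(u, v) \<in> F. e (\<phi> G u) (\<phi> G v)) (u, v) = (\<lambda>(u, v) \<in> F. e (\<phi> G' u) (\<phi> G' v)) (u, v)"
        using G(3) unfolding code_def by simp
      then show ?thesis using that by simp
    qed
    \<comment> \<open>Induction along a path of \<open>F\<close> from \<open>r\<close>: equal images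
      of \<open>u\<close> and equal indices at \<open>(u, v)\<close> give equal images of
      \<open>v\<close>.\<close>
    have eq: "\<phi> G v = \<phi> G' v" if "(r, v) \<in> F\<^sup>*" for v
      using that
    proof induct
      case (step u v)
      have "e (\<phi> G u) (\<phi> G v) = e (\<phi> G u) (\<phi> G' v)" using same_index[OF step(2)] step(3) by simp
      moreover have "\<phi> G v \<in> N (\<phi> G u)" "\<phi> G' v \<in> N (\<phi> G u)"
        using F_image[OF G(1) step(2)] F_image[OF G(2) step(2)] step(3) by simp_all
      ultimately show ?case
        using e(1)[OF in_V[OF G(1) F_V(1)[OF step(2)]]] by (meson inj_onD)
    qed (rule root)
    \<comment> \<open>A graph in the class is the preimage of \<open>G0\<close> under its vertex map
      and hence determined by that map on \<open>V\<close>.\<close>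
    have arcs: "parcs K = {(x, y). x \<in> V \<and> y \<in> V \<and> (\<phi> K x, \<phi> K y) \<in> parcs G0}" if K: "K \<in> ?C" for K
    proof -
      interpret K: pair_graph K using skeleton K by blast
      have sub: "parcs K \<subseteq> V \<times> V" using skeleton[of K] K K.wellformed' by auto
      have inj: "inj_on (\<phi> K) V" and img: "parcs G0 = (\<lambda>(x, y). (\<phi> K x, \<phi> K y)) ` parcs K"
        using \<phi>[OF K] by blast+
      show ?thesis
      proof (intro equalityI subsetI)
        fix a assume "a \<in> parcs K"
        then show "a \<in> {(x, y). x \<in> V \<and> y \<in> V \<and> (\<phi> K x, \<phi> K y) \<in> parcs G0}"
          using sub unfolding img by (cases a) force
      next
        fix a assume "a \<in> {(x, y). x \<in> V \<and> y \<in> V \<and> (\<phi> K x, \<phi> K y) \<in> parcs G0}"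
        then obtain x y where a: "a = (x, y)" "x \<in> V" "y \<in> V" "(\<phi> K x, \<phi> K y) \<in> parcs G0" by blast
        then obtain x' y' where "(x', y') \<in> parcs K" "\<phi> K x = \<phi> K x'" "\<phi> K y = \<phi> K y'"
          unfolding img by auto
        then show "a \<in> parcs K" using a sub inj_onD[OF inj] by (metis SigmaD1 SigmaD2 subsetD)
      qed
    qed
    have "parcs G = parcs G'"
      unfolding arcs[OF G(1)] arcs[OF G(2)]
      by (rule Collect_cong, unfold split_beta) (use eq r(2) in metis)
    moreover have "pverts G = pverts G'" using skeleton G by auto
    ultimately show "G = G'" by simp
  qed
  have fin_codes: "finite (V \<times> (F \<rightarrow>\<^sub>E {..<d}))" using finV finF by (intro finite_cartesian_product finite_PiE) auto
  have "card ?C \<le> card (V \<times> (F \<rightarrow>\<^sub>E {..<d}))"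
    using inj_code code_sub fin_codes by (rule card_inj_on_le)
  also have "\<dots> = card V * d ^ card F" using finF by (simp add: card_cartesian_product card_PiE)
  also have "\<dots> \<le> card V * d ^ (d * card V)"
  proof (cases "d = 0")
    case True
    then have "F = {}" using card_F finF by simp
    then show ?thesis using True by simp
  next
    case False
    then show ?thesis using card_F by (simp add: power_increasing)
  qed
  finally show ?thesis .
qed

text \<open>One representative is taken from each class. Isomorphic graphs satisfy the same
  predicate under \<open>SOME\<close>, so they get the same representative, and each class has at
  most \<open>K\<close> members.\<close>

lemma nonisomorphic_subfamily:
  fixes \<L> :: "'a pair_pre_digraph set"
  assumes fin: "finite \<L>" and wf: "\<And>G. G \<in> \<L> \<Longrightarrow> wf_digraph (with_proj G)"
    and K: "\<And>G0. G0 \<in> \<L> \<Longrightarrow> card {G \<in> \<L>. digraph_iso (with_proj G) (with_proj G0)} \<le> K"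
  obtains \<G> where "\<G> \<subseteq> \<L>" "card \<L> \<le> card \<G> * K"
    "pairwise (\<lambda>G H. \<not> digraph_iso (with_proj G) (with_proj H)) \<G>"
proof -
  let ?iso = "\<lambda>(G :: 'a pair_pre_digraph) (H :: 'a pair_pre_digraph). digraph_iso (with_proj G) (with_proj H)"
  define f where "f G = (SOME H :: 'a pair_pre_digraph. H \<in> \<L> \<and> ?iso G H)" for G
  have f: "f G \<in> \<L> \<and> ?iso G (f G)" if "G \<in> \<L>" for G
    unfolding f_def
  proof (rule someI)
    show "G \<in> \<L> \<and> ?iso G G" using that wf digraph_iso_refl by blast
  qed
  have f_eq: "f G = f H" if "G \<in> \<L>" "H \<in> \<L>" "?iso G H" for G H
  proof -
    have "?iso H G" using that wf digraph_iso_swap by blast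
    then have "?iso G K \<longleftrightarrow> ?iso H K" for K using that(3) digraph_iso_trans by blast
    then show ?thesis unfolding f_def by simp
  qed
  have "pairwise (\<lambda>G H. \<not> ?iso G H) (f ` \<L>)"
  proof (rule pairwiseI, rule notI)
    fix A B assume "A \<in> f ` \<L>" "B \<in> f ` \<L>" "A \<noteq> B" "?iso A B"
    then obtain G H where GH: "G \<in> \<L>" "H \<in> \<L>" "A = f G" "B = f H" by blast
    have "f G = f (f G)" "f H = f (f H)" using f_eq f GH by blast+
    moreover have "f (f G) = f (f H)" using \<open>?iso A B\<close> f GH by (intro f_eq) auto
    ultimately show False using GH \<open>A \<noteq> B\<close> by metis
  qed
  moreover have "card \<L> \<le> card (f ` \<L>) * K"
  proof -
    have "\<L> \<subseteq> (\<Union>G0\<in>f ` \<L>. {G \<in> \<L>. ?iso G G0})" using f by blast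
    then have "card \<L> \<le> card (\<Union>G0\<in>f ` \<L>. {G \<in> \<L>. ?iso G G0})" using fin by (intro card_mono) auto
    also have "\<dots> \<le> (\<Sum>G0\<in>f ` \<L>. card {G \<in> \<L>. ?iso G G0})" using fin by (intro card_UN_le) auto
    also have "\<dots> \<le> (\<Sum>G0\<in>f ` \<L>. K)" using K f by (intro sum_mono) auto
    finally show ?thesis by simp
  qed
  ultimately show ?thesis using that f by blast
qed

section \<open>Port multigraphs built from two cycles\<close>

text \<open>Ports 0 and 1 join the partners \<open>q\<close> and \<open>q + m\<close>. The remaining \<open>d - 3\<close> ports put multiple cycles
  on each side, and for even \<open>d\<close> the last port joins antipodal pieces.\<close>

definition port_swap :: "nat \<Rightarrow> nat \<Rightarrow> nat" where
  "port_swap d k = (if k = d - 2 \<and> even d then k else if even k then k + 1 else k - 1)"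

definition rot :: "nat \<Rightarrow> nat \<Rightarrow> nat" where
  "rot m i = (if i + 1 = m then 0 else i + 1)"

definition cycle_port :: "nat \<Rightarrow> nat \<Rightarrow> nat \<Rightarrow> nat \<Rightarrow> nat" where
  "cycle_port d m k i =
    (if k = d - 2 \<and> even d then (if i < m div 2 then i + m div 2 else i - m div 2)
     else if even k then rot m i else if i = 0 then m - 1 else i - 1)"

definition double_cycle_port :: "nat \<Rightarrow> nat \<Rightarrow> (nat \<Rightarrow> nat) \<Rightarrow> nat \<Rightarrow> nat \<Rightarrow> nat" where
  "double_cycle_port d m \<sigma> k q =
    (if k < 2 then (if q < m then q + m else q - m)
     else if q < m then cycle_port d m k q
     else m + \<sigma> (cycle_port d m k (inv \<sigma> (q - m))))"

lemma port_swap_less: "\<lbrakk>d \<ge> 5; k < d - 1\<rbrakk> \<Longrightarrow> port_swap d k < d - 1"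
  unfolding port_swap_def by (auto; presburger)

lemma port_swap_ge: "2 \<le> k \<Longrightarrow> 2 \<le> port_swap d k"
  unfolding port_swap_def by (auto; presburger)

lemma port_swap_small: "\<lbrakk>d \<ge> 5; k < 2\<rbrakk> \<Longrightarrow> port_swap d k < 2"
  unfolding port_swap_def by auto

lemma port_swap_swap: "\<lbrakk>d \<ge> 5; k < d - 1\<rbrakk> \<Longrightarrow> port_swap d (port_swap d k) = k"
  unfolding port_swap_def by (auto; presburger)

context
  fixes d m :: nat
  assumes d: "d \<ge> 5" and m: "even m" "m \<ge> d"
begin

lemma cycle_port_less: "i < m \<Longrightarrow> cycle_port d m k i < m"
  using m d unfolding cycle_port_def rot_def by auto

lemma cycle_port_neq: "i < m \<Longrightarrow> cycle_port d m k i \<noteq> i"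
  using m d unfolding cycle_port_def rot_def by auto

lemma cycle_port_swap:
  assumes "2 \<le> k" "k < d - 1" "i < m"
  shows "cycle_port d m (port_swap d k) (cycle_port d m k i) = i"
proof -
  consider "k = d - 2" "even d" | "\<not> (k = d - 2 \<and> even d)" "even k" | "\<not> (k = d - 2 \<and> even d)" "odd k"
    by blast
  then show ?thesis
  proof cases
    case 1
    then show ?thesis using assms m by (auto simp: cycle_port_def port_swap_def elim!: evenE)
  next
    case 2
    then have "port_swap d k = k + 1" "\<not> (k + 1 = d - 2 \<and> even d)"
      by (simp_all add: port_swap_def) presburger
    then show ?thesis using assms 2 by (auto simp: cycle_port_def rot_def)
  next
    case 3
    then have k: "port_swap d k = k - 1" "even (k - 1)"
      by (auto simp: port_swap_def)
    have "k - 1 \<noteq> d - 2" using assms by linarith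
    then show ?thesis using assms 3 k by (auto simp: cycle_port_def rot_def)
  qed
qed

text \<open>Around the cycle, \<open>A\<close> is left from some \<open>a\<close> and entered from
  some \<open>c\<close>. Each even cyclic port contributes the first edge and each odd one the
  second: \<open>d - 3\<close> edges for odd \<open>d\<close>, \<open>d - 4\<close> for even
  \<open>d\<close>. For even \<open>d\<close> one more is an antipodal edge leaving \<open>A\<close>
  or, if \<open>A\<close> is closed under antipodes, the forward edge at the antipode of
  \<open>a\<close>.\<close>

lemma cycle_cut:
  assumes "A \<subseteq> {..<m}" "A \<noteq> {}" "A \<noteq> {..<m}"
  shows "d - 3 \<le> card {(i, k). i \<in> A \<and> 2 \<le> k \<and> k < d - 1 \<and> cycle_port d m k i \<notin> A}"
proof -
  let ?D = "{(i, k). i \<in> A \<and> 2 \<le> k \<and> k < d - 1 \<and> cycle_port d m k i \<notin> A}"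
  have fin: "finite ?D"
    by (rule finite_subset[of _ "{..<m} \<times> {..<d}"]) (use assms(1) in auto)
  have leave: "\<exists>i \<in> B. rot m i \<notin> B" if B: "B \<subseteq> {..<m}" "B \<noteq> {}" "B \<noteq> {..<m}" for B
  proof (rule ccontr)
    assume closed: "\<not> ?thesis"
    obtain b where b: "b \<in> B" "b < m" using B by blast
    have up: "b' \<in> B \<Longrightarrow> b' + j < m \<Longrightarrow> b' + j \<in> B" for b' j
    proof (induct j)
      case (Suc j)
      then have "rot m (b' + j) \<in> B" "b' + j + 1 \<noteq> m" using closed by auto
      then show ?case by (simp add: rot_def)
    qed simp
    have "m - 1 \<in> B" using up[of b "m - 1 - b"] b by simp
    then have "rot m (m - 1) \<in> B" using closed by blast
    then have "0 \<in> B" using b by (simp add: rot_def)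
    then have "{..<m} \<subseteq> B" using up[of 0] by auto
    then show False using B by blast
  qed
  obtain a where a: "a \<in> A" "rot m a \<notin> A" using leave[OF assms] by blast
  have "\<exists>c \<in> {..<m} - A. rot m c \<notin> {..<m} - A" using assms by (intro leave) auto
  then obtain c where c: "c < m" "c \<notin> A" "rot m c \<in> A" using m d by (auto simp: rot_def split: if_splits)
  \<comment> \<open>Odd cyclic ports run backwards, so through them \<open>rot m c\<close> leaves
    \<open>A\<close> towards \<open>c\<close>.\<close>
  let ?g = "\<lambda>k. (if even k then a else rot m c, k)"
  let ?K = "{k. 2 \<le> k \<and> k < d - 1 \<and> \<not> (k = d - 2 \<and> even d)}"
  have gD: "?g ` ?K \<subseteq> ?D"
    using a c by (auto simp: cycle_port_def rot_def split: if_splits)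
  have inj: "inj_on ?g ?K" by (auto simp: inj_on_def)
  show ?thesis
  proof (cases "even d")
    case False
    then have "?K = {2..<d - 1}" by auto
    then have "card (?g ` ?K) = d - 3" using card_image[OF inj] by simp
    then show ?thesis using card_mono[OF fin gD] by simp
  next
    case True
    then have "?K = {2..<d - 2}" using d by auto
    then have card: "card (?g ` ?K) = d - 4" using card_image[OF inj] by simp
    have d6: "d \<ge> 6" using True d by presburger
    define opp where "opp i = (if i < m div 2 then i + m div 2 else i - m div 2)" for i
    have port: "cycle_port d m (d - 2) i = opp i" "cycle_port d m 2 i = rot m i" for i
      using True d6 by (auto simp: cycle_port_def opp_def)
    have "\<exists>x \<in> ?D. x \<notin> ?g ` ?K"
    proof (cases "\<exists>i \<in> A. opp i \<notin> A")
      case ex: True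
      then obtain i where i: "i \<in> A" "opp i \<notin> A" by blast
      have "(i, d - 2) \<in> ?D" using i d6 by (simp add: port) linarith
      moreover have "(i, d - 2) \<notin> ?g ` ?K" using True by auto
      ultimately show ?thesis by blast
    next
      case closed: False
      have am: "a < m" using a assms by blast
      have opp: "opp (opp i) = i" "opp i \<noteq> i" "rot m (opp i) = opp (rot m i)" if "i < m" for i
        using that m d by (auto simp: rot_def opp_def elim!: evenE)
      have "opp a \<in> A" using a(1) closed by blast
      moreover have "rot m (opp a) \<notin> A"
      proof
        assume "rot m (opp a) \<in> A"
        then have "opp (rot m a) \<in> A" using opp(3)[OF am] by simp
        then have "opp (opp (rot m a)) \<in> A" using closed by blast
        moreover have "rot m a < m" using am by (auto simp: rot_def)
        ultimately show False using opp(1) a(2) by metis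
      qed
      ultimately have "(opp a, 2) \<in> ?D" using d6 by (simp add: port)
      moreover have "(opp a, 2) \<notin> ?g ` ?K" using opp(2)[OF am] by auto
      ultimately show ?thesis by blast
    qed
    then obtain x where x: "x \<in> ?D" "x \<notin> ?g ` ?K" by blast
    then have "card (insert x (?g ` ?K)) \<le> card ?D" using fin gD by (intro card_mono) auto
    moreover have "finite (?g ` ?K)" using gD fin by (rule finite_subset)
    ultimately show ?thesis using card x d6 by simp
  qed
qed

context
  fixes \<sigma> :: "nat \<Rightarrow> nat"
  assumes \<sigma>: "\<sigma> permutes {..<m}"
begin

lemma perm_less [simp]: "\<sigma> i < m \<longleftrightarrow> i < m" "inv \<sigma> i < m \<longleftrightarrow> i < m"
  using permutes_in_image[OF \<sigma>] permutes_in_image[OF permutes_inv[OF \<sigma>]] by auto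

lemma perm_inv [simp]: "\<sigma> (inv \<sigma> i) = i" "inv \<sigma> (\<sigma> i) = i"
  using permutes_inverses[OF \<sigma>] by auto

text \<open>A nontrivial trace of \<open>A\<close> on one half contributes at least
  \<open>d - 3\<close> edges, and each index where the two traces differ contributes two partner
  edges. Two nontrivial traces give \<open>2 * (d - 3) \<ge> d - 1\<close>, one gives
  \<open>(d - 3) + 2\<close>, and none gives \<open>2 * m\<close>.\<close>

lemma double_cycle_cut:
  assumes A: "A \<subseteq> {..<2 * m}" "A \<noteq> {}" "A \<noteq> {..<2 * m}"
  shows "d - 1 \<le> card {(q, k). q \<in> A \<and> k < d - 1 \<and> double_cycle_port d m \<sigma> k q \<notin> A}"
proof -
  let ?D = "{(q, k). q \<in> A \<and> k < d - 1 \<and> double_cycle_port d m \<sigma> k q \<notin> A}"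
  define A0 where "A0 = {i. i < m \<and> i \<in> A}"
  define A1 where "A1 = {i. i < m \<and> m + i \<in> A}"
  \<comment> \<open>Pulling the second trace back along \<open>\<sigma>\<close> turns the permuted
    ports into plain \<open>cycle_port\<close>, so \<open>cycle_cut\<close> applies.\<close>
  define A1' where "A1' = {i. i < m \<and> m + \<sigma> i \<in> A}"
  define D0 where "D0 = {(q, k). q \<in> A0 \<and> 2 \<le> k \<and> k < d - 1 \<and> cycle_port d m k q \<notin> A0}"
  define D1 where "D1 = {(i, k). i \<in> A1' \<and> 2 \<le> k \<and> k < d - 1 \<and> cycle_port d m k i \<notin> A1'}"
  define f where "f = (\<lambda>(i, k :: nat). (m + \<sigma> i, k))"
  define D2 where "D2 = {(q, k). q \<in> A \<and> k < 2 \<and> double_cycle_port d m \<sigma> k q \<notin> A}"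
  have fin: "finite ?D"
    by (rule finite_subset[of _ "{..<2 * m} \<times> {..<d}"]) (use A in auto)
  have sub: "D0 \<subseteq> ?D" "f ` D1 \<subseteq> ?D" "D2 \<subseteq> ?D"
    using cycle_port_less d
    by (auto simp: D0_def D1_def D2_def f_def A0_def A1'_def double_cycle_port_def split: if_splits)
  have fin': "finite D0" "finite (f ` D1)" "finite D2"
    using sub fin by (auto intro: finite_subset)
  have disj: "D0 \<inter> f ` D1 = {}" "(D0 \<union> f ` D1) \<inter> D2 = {}"
    by (auto simp: D0_def D1_def D2_def f_def A0_def)
  have "inj_on f D1" using perm_inv(2) by (auto simp: inj_on_def f_def) (metis perm_inv(2))
  then have "card (f ` D1) = card D1" by (rule card_image)
  then have "card D0 + card D1 + card D2 = card (D0 \<union> f ` D1 \<union> D2)"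
    using fin' disj by (simp add: card_Un_disjoint)
  also have "\<dots> \<le> card ?D" using sub by (intro card_mono[OF fin]) auto
  finally have total: "card D0 + card D1 + card D2 \<le> card ?D" .
  have c0: "d - 3 \<le> card D0" if "A0 \<noteq> {}" "A0 \<noteq> {..<m}"
    unfolding D0_def using that by (intro cycle_cut) (auto simp: A0_def)
  have c1: "d - 3 \<le> card D1" if "A1' \<noteq> {}" "A1' \<noteq> {..<m}"
    unfolding D1_def using that by (intro cycle_cut) (auto simp: A1'_def)
  have perm_A1: "\<sigma> i \<in> A1 \<longleftrightarrow> i \<in> A1'" "inv \<sigma> i \<in> A1' \<longleftrightarrow> i \<in> A1" for i
    by (auto simp: A1_def A1'_def)
  have A1'_triv: "A1' = {} \<longleftrightarrow> A1 = {}" "A1' = {..<m} \<longleftrightarrow> A1 = {..<m}"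
  proof -
    show "A1' = {} \<longleftrightarrow> A1 = {}" using perm_A1 by blast
    have "A1' \<subseteq> {..<m}" "A1 \<subseteq> {..<m}" by (auto simp: A1_def A1'_def)
    moreover have "{..<m} \<subseteq> A1' \<longleftrightarrow> {..<m} \<subseteq> A1" using perm_A1 perm_less by blast
    ultimately show "A1' = {..<m} \<longleftrightarrow> A1 = {..<m}" by blast
  qed
  define Z where "Z = (A0 - A1) \<union> (\<lambda>i. m + i) ` (A1 - A0)"
  have "Z \<times> {..<2} \<subseteq> D2"
    by (auto simp: Z_def D2_def A0_def A1_def double_cycle_port_def add.commute)
  then have "card (Z \<times> {..<2 :: nat}) \<le> card D2" using fin'(3) by (rule card_mono[rotated])
  moreover have "card Z = card (A0 - A1) + card ((\<lambda>i. m + i) ` (A1 - A0))"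
    unfolding Z_def by (intro card_Un_disjoint) (auto simp: A0_def A1_def)
  moreover have "card ((\<lambda>i. m + i) ` (A1 - A0)) = card (A1 - A0)"
    by (rule card_image) (auto simp: inj_on_def)
  ultimately have c2: "2 * (card (A0 - A1) + card (A1 - A0)) \<le> card D2"
    by (simp add: card_cartesian_product)
  have fin01: "finite A0" "finite A1" by (auto simp: A0_def A1_def)
  have c2': "2 \<le> card D2" if "A0 \<noteq> A1"
  proof -
    have "A0 - A1 \<noteq> {} \<or> A1 - A0 \<noteq> {}" using that by blast
    then have "1 \<le> card (A0 - A1) \<or> 1 \<le> card (A1 - A0)" using fin01 by (auto simp: Suc_le_eq card_gt_0_iff)
    then show ?thesis using c2 by auto
  qed
  have sub01: "A0 \<subseteq> {..<m}" "A1 \<subseteq> {..<m}" by (auto simp: A0_def A1_def)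
  have split: "q \<in> A \<longleftrightarrow> (if q < m then q \<in> A0 else q - m \<in> A1)" if "q < 2 * m" for q
    using that by (auto simp: A0_def A1_def)
  consider "A0 \<noteq> {}" "A0 \<noteq> {..<m}" "A1 \<noteq> {}" "A1 \<noteq> {..<m}"
    | "A0 \<noteq> {}" "A0 \<noteq> {..<m}" "A1 = {} \<or> A1 = {..<m}"
    | "A0 = {} \<or> A0 = {..<m}" "A1 \<noteq> {}" "A1 \<noteq> {..<m}"
    | "A0 = {} \<or> A0 = {..<m}" "A1 = {} \<or> A1 = {..<m}" by blast
  then show ?thesis
  proof cases
    case 1
    then show ?thesis using c0 c1 A1'_triv total d by simp
  next
    case 2
    then have "A0 \<noteq> A1" by blast
    then show ?thesis using 2 c0 c2' total d by simp
  next
    case 3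
    then have "A0 \<noteq> A1" by blast
    then show ?thesis using 3 c1 A1'_triv c2' total d by simp
  next
    case 4
    have "A0 \<noteq> A1"
    proof
      assume eq: "A0 = A1"
      then consider "A0 = {}" "A1 = {}" | "A0 = {..<m}" "A1 = {..<m}" using 4 by blast
      then show False
      proof cases
        case 1
        then have "q \<notin> A" if "q < 2 * m" for q using split[OF that] by simp
        then show False using A by blast
      next
        case 2
        then have "q \<in> A" if "q < 2 * m" for q using split[OF that] that by auto
        then show False using A by blast
      qed
    qed
    then have "(A0 = {} \<and> A1 = {..<m}) \<or> (A1 = {} \<and> A0 = {..<m})" using 4 by blast
    then have "m \<le> card (A0 - A1) + card (A1 - A0)" by auto
    moreover have "d - 1 \<le> z" if "m \<le> x" "2 * x \<le> z" for x z :: nat using that m(2) by linarith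
    ultimately have "d - 1 \<le> card D2" using c2 by blast
    also have "\<dots> \<le> card ?D" using sub(3) by (rule card_mono[OF fin])
    finally show ?thesis .
  qed
qed

lemma port_multigraph_double_cycle: "port_multigraph d (2 * m) (double_cycle_port d m \<sigma>) (port_swap d)"
proof
  show "d \<ge> 5" by (rule d)
  show "2 * m > 0" using m d by simp
  show "port_swap d 0 = 1" using d by (simp add: port_swap_def)
  show "double_cycle_port d m \<sigma> 1 q = double_cycle_port d m \<sigma> 0 q" if "q < 2 * m" for q by (simp add: double_cycle_port_def)
  show "d - 1 \<le> card {(q, k). q \<in> A \<and> k < d - 1 \<and> double_cycle_port d m \<sigma> k q \<notin> A}"
    if "A \<subseteq> {..<2 * m}" "A \<noteq> {}" "A \<noteq> {..<2 * m}" for A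
    using that by (rule double_cycle_cut)
  fix k assume k: "k < d - 1"
  show "port_swap d k < d - 1" "port_swap d (port_swap d k) = k"
    using port_swap_less port_swap_swap d k by auto
  fix q assume q: "q < 2 * m"
  have less: "cycle_port d m k i < m" if "i < m" for i using that by (rule cycle_port_less)
  show "double_cycle_port d m \<sigma> k q < 2 * m" using q less[of q] less[of "inv \<sigma> (q - m)"] by (auto simp: double_cycle_port_def)
  show "double_cycle_port d m \<sigma> k q \<noteq> q"
  proof (cases "k < 2 \<or> q < m")
    case True
    then show ?thesis using cycle_port_neq[of q k] m d by (auto simp: double_cycle_port_def)
  next
    case False
    then have "inv \<sigma> (q - m) < m" using q by simp
    then have "cycle_port d m k (inv \<sigma> (q - m)) \<noteq> inv \<sigma> (q - m)" by (rule cycle_port_neq)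
    then have "\<sigma> (cycle_port d m k (inv \<sigma> (q - m))) \<noteq> q - m" by (metis perm_inv(2))
    then show ?thesis using False by (auto simp: double_cycle_port_def)
  qed
  show "double_cycle_port d m \<sigma> (port_swap d k) (double_cycle_port d m \<sigma> k q) = q"
  proof (cases "k < 2")
    case True
    then show ?thesis using port_swap_small[OF d True] q by (auto simp: double_cycle_port_def)
  next
    case False
    then have "\<not> port_swap d k < 2" using port_swap_ge[of k d] by simp
    then show ?thesis
      using False q k cycle_port_swap[of k q] cycle_port_swap[of k "inv \<sigma> (q - m)"] less[of q]
        less[of "inv \<sigma> (q - m)"]
      by (auto simp: double_cycle_port_def)
  qed
qed

end

end

section \<open>The labelled family and its common skeleton\<close>

definition double_cycle_graph :: "nat \<Rightarrow> nat \<Rightarrow> (nat \<Rightarrow> nat) \<Rightarrow> nat pair_pre_digraph" where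
  "double_cycle_graph d m \<sigma> = piece_graph d (2 * m) (double_cycle_port d m \<sigma>) (port_swap d)"

text \<open>Among these arcs are those inside the pieces, those between partners and those of the
  cycles on the unpermuted half.\<close>

definition skeleton :: "nat \<Rightarrow> nat \<Rightarrow> nat rel" where
  "skeleton d m = (\<Inter>\<sigma> \<in> {\<sigma>. \<sigma> permutes {..<m}}. parcs (double_cycle_graph d m \<sigma>))"

lemma skeletonI:
  assumes "q < 2 * m" "q' < 2 * m" "k < d + 2" "k' < d + 2"
    "\<And>\<sigma>. piece_adj d (double_cycle_port d m \<sigma>) (port_swap d) q k q' k'"
  shows "(vx d q k, vx d q' k') \<in> skeleton d m"
  using assms by (simp add: skeleton_def double_cycle_graph_def piece_graph_arcs_iff)

text \<open>Position 0 reaches its whole piece in at most two steps, through position 2 or 3. Port 2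
  of a piece meets port 3 of the next one on the unpermuted half, and the other half is reached
  through partners.\<close>

lemma skeleton_connected:
  assumes d: "d \<ge> 5" and v: "v < 2 * m * (d + 2)"
  shows "(0, v) \<in> (skeleton d m)\<^sup>*"
proof -
  have inner: "(vx d q k, vx d q k') \<in> (skeleton d m)\<^sup>*"
    if "q < 2 * m" "k < d + 2" "k' < d + 2" "k \<noteq> k'" "\<not> gap d k k'" for q k k'
    using that by (intro r_into_rtrancl skeletonI) (auto simp: piece_adj_def)
  have partner: "(vx d q 0, vx d (q + m) 0) \<in> (skeleton d m)\<^sup>*" if "q < m" for q
    using that d by (intro r_into_rtrancl skeletonI) (auto simp: piece_adj_def double_cycle_port_def)
  have succ: "(vx d q 2, vx d (Suc q) 3) \<in> (skeleton d m)\<^sup>*" if "Suc q < m" for q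
    using that d by (intro r_into_rtrancl skeletonI)
      (auto simp: piece_adj_def double_cycle_port_def cycle_port_def port_swap_def rot_def)
  have piece: "(vx d q 0, vx d q k) \<in> (skeleton d m)\<^sup>*" if q: "q < 2 * m" and k: "k < d + 2" for q k
  proof -
    have "(vx d q 0, vx d q 2) \<in> (skeleton d m)\<^sup>*" "(vx d q 0, vx d q 3) \<in> (skeleton d m)\<^sup>*"
      using q d by (auto intro!: inner simp: gap_def)
    moreover have "(vx d q 2, vx d q d) \<in> (skeleton d m)\<^sup>*" "(vx d q 2, vx d q (d + 1)) \<in> (skeleton d m)\<^sup>*"
      "(vx d q 3, vx d q 1) \<in> (skeleton d m)\<^sup>*"
      using q d by (auto intro!: inner simp: gap_def)
    moreover have "(vx d q 0, vx d q k) \<in> (skeleton d m)\<^sup>*" if "k \<noteq> 1" "k \<noteq> d" "k \<noteq> d + 1"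
    proof (cases "k = 0")
      case False
      then show ?thesis using q k d that by (intro inner) (auto simp: gap_def)
    qed simp
    ultimately show ?thesis by (metis rtrancl_trans)
  qed
  have side0: "(0, vx d q 0) \<in> (skeleton d m)\<^sup>*" if "q < m" for q
    using that
  proof (induct q)
    case 0
    then show ?case by (simp add: vx_def)
  next
    case (Suc q)
    have "(vx d q 0, vx d q 2) \<in> (skeleton d m)\<^sup>*" using Suc d by (intro piece) auto
    moreover have "(vx d q 2, vx d (Suc q) 3) \<in> (skeleton d m)\<^sup>*" using Suc by (intro succ)
    moreover have "(vx d (Suc q) 3, vx d (Suc q) 0) \<in> (skeleton d m)\<^sup>*"
      using Suc d by (intro inner) (auto simp: gap_def)
    ultimately show ?case using Suc by (meson Suc_lessD rtrancl_trans)
  qed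
  obtain q k where qk: "q < 2 * m" "k < d + 2" "v = vx d q k" using v by (rule vx_cases)
  have "(0, vx d q 0) \<in> (skeleton d m)\<^sup>*"
  proof (cases "q < m")
    case False
    then have "(0, vx d (q - m) 0) \<in> (skeleton d m)\<^sup>*" "(vx d (q - m) 0, vx d (q - m + m) 0) \<in> (skeleton d m)\<^sup>*"
      using qk by (intro side0 partner; simp)+
    then show ?thesis using False by (metis le_add_diff_inverse2 not_less rtrancl_trans)
  qed (rule side0)
  then show ?thesis using piece[OF qk(1,2)] qk(3) by (metis rtrancl_trans)
qed

text \<open>Port 2 leads from piece \<open>m + \<sigma> i\<close> to piece
  \<open>m + \<sigma> (Suc i)\<close>, so the graph determines \<open>\<sigma>\<close> step by step
  from \<open>\<sigma> 0 = 0\<close>. Fixing 0 excludes composing \<open>\<sigma>\<close> with a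
  rotation, which would give the same graph.\<close>

lemma double_cycle_graph_inj:
  assumes d: "d \<ge> 5" and m: "m \<ge> 2"
  shows "inj_on (double_cycle_graph d m) {\<sigma>. \<sigma> permutes {1..<m}}"
proof (rule inj_onI, clarify)
  fix \<sigma> \<tau> assume perm: "\<sigma> permutes {1..<m}" "\<tau> permutes {1..<m}"
    and eq: "double_cycle_graph d m \<sigma> = double_cycle_graph d m \<tau>"
  have perm': "\<sigma> permutes {..<m}" "\<tau> permutes {..<m}" using perm by (auto intro: permutes_subset)
  have less: "\<sigma> i < m \<longleftrightarrow> i < m" "\<tau> i < m \<longleftrightarrow> i < m" for i
    using permutes_in_image[OF perm'(1)] permutes_in_image[OF perm'(2)] by auto
  have two: "\<not> (2 = d - 2 \<and> even d)" using d by presburger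
  have same: "\<sigma> i = \<tau> i" if "i < m" for i
    using that
  proof (induct i)
    case 0
    then show ?case using permutes_not_in[OF perm(1), of 0] permutes_not_in[OF perm(2), of 0] by simp
  next
    case (Suc i)
    have "\<sigma> i \<noteq> \<sigma> (Suc i)" using permutes_inj[OF perm(1)] by (metis injD n_not_Suc_n)
    have port: "double_cycle_port d m \<sigma> 2 (m + \<sigma> i) = m + \<sigma> (Suc i)"
      "double_cycle_port d m \<tau> 2 (m + \<tau> i) = m + \<tau> (Suc i)"
      using two Suc(2) permutes_inverses(2)[OF perm(1)] permutes_inverses(2)[OF perm(2)]
      by (auto simp: double_cycle_port_def cycle_port_def rot_def)
    have swap: "port_swap d 2 = 3" using two by (auto simp: port_swap_def)
    have "(vx d (m + \<sigma> i) 2, vx d (m + \<sigma> (Suc i)) 3) \<in> parcs (double_cycle_graph d m \<sigma>)"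
    proof -
      have "2 < d - 1" using d by linarith
      then show ?thesis using d port less Suc(2) swap
        by (simp add: double_cycle_graph_def piece_graph_arcs_iff piece_adj_def)
    qed
    then have "piece_adj d (double_cycle_port d m \<tau>) (port_swap d) (m + \<sigma> i) 2 (m + \<sigma> (Suc i)) 3"
      unfolding eq using d by (simp add: double_cycle_graph_def piece_graph_arcs_iff)
    \<comment> \<open>The two pieces differ and position 2 is not 0, so only the port disjunct of
      \<open>piece_adj\<close> is left.\<close>
    then have "m + \<sigma> (Suc i) = double_cycle_port d m \<tau> 2 (m + \<sigma> i)"
      using \<open>\<sigma> i \<noteq> \<sigma> (Suc i)\<close> by (auto simp: piece_adj_def)
    then show ?case using Suc port(2) by simp
  qed
  show "\<sigma> = \<tau>"
  proof
    fix i show "\<sigma> i = \<tau> i"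
      using same permutes_not_in[OF perm'(1), of i] permutes_not_in[OF perm'(2), of i] by (cases "i < m") auto
  qed
qed

section \<open>Factorial growth against exponential bounds\<close>

text \<open>The terms of the exponential series tend to 0.\<close>

lemma eventually_power_less_fact:
  fixes B :: real
  assumes "B > 0"
  shows "eventually (\<lambda>h. B ^ h < fact h) sequentially"
proof -
  have "(\<lambda>h. B ^ h / fact h) \<longlonglongrightarrow> 0"
    using summable_LIMSEQ_zero[OF summable_exp[of B]] by (simp add: field_simps)
  then have "eventually (\<lambda>h. B ^ h / fact h < 1) sequentially"
    by (rule order_tendstoD) simp
  then show ?thesis by (simp add: field_simps)
qed

lemma many_graphs:
  assumes d: "d \<ge> 5" and h: "h \<ge> d"
  obtains \<G> :: "nat pair_pre_digraph set" where "finite \<G>"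
    "fact h \<le> card \<G> * (4 * h * (d + 2) * d ^ (d * (4 * h * (d + 2))))"
    "\<And>G. G \<in> \<G> \<Longrightarrow> pair_graph G \<and> card (pverts G) = 4 * h * (d + 2) \<and> regular_graph d G \<and>
       k_connected (d - 1) G \<and> \<not> contains_complete_subdivision (d + 1) G"
    "pairwise (\<lambda>G H. \<not> digraph_iso (with_proj G) (with_proj H)) \<G>"
proof -
  \<comment> \<open>The antipodal port needs an even \<open>m\<close>; then \<open>2 * m\<close>
    pieces of \<open>d + 2\<close> vertices make up \<open>n\<close>.\<close>
  define m where "m = 2 * h"
  define n where "n = 4 * h * (d + 2)"
  have m: "even m" "m \<ge> d" "m \<ge> 2" "2 * m * (d + 2) = n" using h d by (auto simp: m_def n_def)
  let ?S = "{\<sigma>. \<sigma> permutes {1..<m}}"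
  define \<L> where "\<L> = double_cycle_graph d m ` ?S"
  have perm: "\<sigma> permutes {..<m}" if "\<sigma> \<in> ?S" for \<sigma> using that by (auto intro: permutes_subset)
  have card_S: "card ?S = fact (m - 1)" by (rule card_permutations) auto
  then have fin: "finite \<L>" by (simp add: \<L>_def finite_permutations)
  have "card \<L> = fact (m - 1)"
    unfolding \<L>_def using card_image[OF double_cycle_graph_inj[OF d m(3)]] card_S by simp
  \<comment> \<open>The factorial of \<open>m - 1\<close> is weakened to that of \<open>h\<close>,
    which still outgrows every exponential in \<open>n\<close>.\<close>
  moreover have "h \<le> m - 1" using h d by (simp add: m_def)
  ultimately have card_L: "fact h \<le> card \<L>" by (simp add: fact_mono)
  have props: "pair_graph G" "pverts G = {..<n}" "regular_graph d G" "k_connected (d - 1) G"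
      "\<not> contains_complete_subdivision (d + 1) G" "skeleton d m \<subseteq> parcs G" if G: "G \<in> \<L>" for G
  proof -
    obtain \<sigma> where \<sigma>: "\<sigma> \<in> ?S" "G = double_cycle_graph d m \<sigma>" using G unfolding \<L>_def by blast
    interpret port_multigraph d "2 * m" "double_cycle_port d m \<sigma>" "port_swap d"
      using d m(1,2) perm[OF \<sigma>(1)] by (rule port_multigraph_double_cycle)
    show "pair_graph G" "regular_graph d G" "k_connected (d - 1) G" "\<not> contains_complete_subdivision (d + 1) G"
      using pair_graph_G regular_G k_connected_G no_complete_subdivision
      by (simp_all add: \<sigma>(2) double_cycle_graph_def)
    show "pverts G = {..<n}" using m(4) by (simp add: \<sigma>(2) double_cycle_graph_def)
    show "skeleton d m \<subseteq> parcs G" using perm[OF \<sigma>(1)] by (auto simp: skeleton_def \<sigma>(2))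
  qed
  have iso_class: "card {G \<in> \<L>. digraph_iso (with_proj G) (with_proj G0)} \<le> n * d ^ (d * n)" if "G0 \<in> \<L>" for G0
  proof -
    have "card {G \<in> \<L>. digraph_iso (with_proj G) (with_proj G0)} \<le> card {..<n} * d ^ (d * card {..<n})"
    proof (rule card_isomorphic_copies)
      show "0 \<in> {..<n}" using h d by (simp add: n_def)
      show "(0, v) \<in> (skeleton d m)\<^sup>*" if "v \<in> {..<n}" for v
        using that m(4) by (intro skeleton_connected[OF d]) simp
    qed (use props that in auto)
    then show ?thesis by simp
  qed
  have wf: "wf_digraph (with_proj G)" if "G \<in> \<L>" for G
  proof -
    interpret pair_graph G using props(1)[OF that] .
    show ?thesis by unfold_locales
  qed
  obtain \<G> where \<G>: "\<G> \<subseteq> \<L>" "card \<L> \<le> card \<G> * (n * d ^ (d * n))"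
      "pairwise (\<lambda>G H. \<not> digraph_iso (with_proj G) (with_proj H)) \<G>"
    using nonisomorphic_subfamily[OF fin wf iso_class] by blast
  show ?thesis
  proof (rule that)
    show "finite \<G>" using \<G>(1) fin by (rule finite_subset)
    show "fact h \<le> card \<G> * (4 * h * (d + 2) * d ^ (d * (4 * h * (d + 2))))"
      using card_L \<G>(2) unfolding n_def by linarith
    show "pair_graph G \<and> card (pverts G) = 4 * h * (d + 2) \<and> regular_graph d G \<and>
       k_connected (d - 1) G \<and> \<not> contains_complete_subdivision (d + 1) G" if "G \<in> \<G>" for G
    proof -
      have "G \<in> \<L>" using \<G>(1) that by blast
      then show ?thesis using props[of G] by (simp add: n_def)
    qed
  qed (rule \<G>(3))
qed

theorem mainTheorem1:
  fixes d :: nat and c :: real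
  assumes "d \<ge> 5" and "c > 0"
  shows "infinite {n :: nat. n > 0 \<and>
           (\<exists>\<G> :: nat pair_pre_digraph set.
              finite \<G> \<and> real (card \<G>) > c ^ n \<and>
              (\<forall>G \<in> \<G>. pair_graph G \<and> card (pverts G) = n \<and>
                 regular_graph d G \<and> k_connected (d - 1) G \<and>
                 \<not> contains_complete_subdivision (d + 1) G) \<and>
              pairwise (\<lambda>G H. \<not> digraph_iso (with_proj G) (with_proj H)) \<G>)}"
    (is "infinite ?N")
proof -
  \<comment> \<open>Chosen so that \<open>B ^ h = (c * (2 * d ^ d)) ^ n\<close> for
    \<open>n = 4 * h * (d + 2)\<close>: the factor \<open>d ^ d\<close> pays for the size of the
    isomorphism classes, and the 2 absorbs their factor \<open>n\<close> by
    \<open>n \<le> 2 ^ n\<close>.\<close>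
  define B :: real where "B = (c * (2 * real d ^ d)) ^ (4 * (d + 2))"
  have "B > 0" using assms by (simp add: B_def)
  then obtain h0 where h0: "\<And>h. h \<ge> h0 \<Longrightarrow> B ^ h < fact h"
    using eventually_power_less_fact[of B] by (auto simp: eventually_sequentially)
  have "4 * h * (d + 2) \<in> ?N" if "h \<in> {max d h0..}" for h
  proof -
    have h: "h \<ge> max d h0" using that by simp
    define n where "n = 4 * h * (d + 2)"
    obtain \<G> :: "nat pair_pre_digraph set" where \<G>: "finite \<G>"
      "fact h \<le> card \<G> * (n * d ^ (d * n))"
      "\<And>G. G \<in> \<G> \<Longrightarrow> pair_graph G \<and> card (pverts G) = n \<and> regular_graph d G \<and>
         k_connected (d - 1) G \<and> \<not> contains_complete_subdivision (d + 1) G"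
      "pairwise (\<lambda>G H. \<not> digraph_iso (with_proj G) (with_proj H)) \<G>"
      using many_graphs[of d h] assms(1) h unfolding n_def by auto
    have "c ^ n < card \<G>"
    proof (rule ccontr)
      assume "\<not> c ^ n < card \<G>"
      then have le: "real (card \<G>) \<le> c ^ n" by simp
      have "fact h = real (fact h)" by simp
      also have "\<dots> \<le> real (card \<G>) * (real n * real d ^ (d * n))"
        using of_nat_mono[OF \<G>(2), where 'a = real] by simp
      also have "\<dots> \<le> c ^ n * (2 ^ n * real d ^ (d * n))"
        using le assms(2) less_imp_le[OF of_nat_less_two_power[of n, where 'a = real]]
        by (intro mult_mono mult_right_mono) simp_all
      also have "\<dots> = (c * (2 * real d ^ d)) ^ n" by (simp only: power_mult_distrib power_mult)
      also have "n = 4 * (d + 2) * h" by (simp add: n_def algebra_simps)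
      also have "(c * (2 * real d ^ d)) ^ (4 * (d + 2) * h) = B ^ h" by (simp only: B_def power_mult)
      finally show False using h0[of h] h by simp
    qed
    moreover have "n > 0" using h assms(1) by (simp add: n_def)
    ultimately show ?thesis using \<G> unfolding n_def[symmetric] by blast
  qed
  then have "(\<lambda>h. 4 * h * (d + 2)) ` {max d h0..} \<subseteq> ?N" by (rule image_subsetI)
  moreover have "infinite ((\<lambda>h. 4 * h * (d + 2)) ` {max d h0..})"
  proof
    assume "finite ((\<lambda>h. 4 * h * (d + 2)) ` {max d h0..})"
    moreover have "inj_on (\<lambda>h. 4 * h * (d + 2)) {max d h0..}"
      by (rule inj_onI) (simp only: mult_cancel_left mult_cancel_right, simp)
    ultimately have "finite {max d h0..}" by (rule finite_imageD)
    then show False using infinite_Ici by blast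
  qed
  ultimately show ?thesis by (rule infinite_super)
qed

end
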